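(* Let $s\ge 2$ be an integer. The bifurcation set $\mathcal{E}\subset[0,\frac{s}{s+1}]$ of the family $(Q_\gamma)_{\gamma\in\mathbb{R}}$ has zero Lebesgue measure and Hausdorff dimension $HD(\mathcal{E})=1$, although $HD(\mathcal{E}\setminus[0,\delta))<1$ for all $\delta>0$.
   Context: For fixed $s$ and $\gamma\in\mathbb{R}$, $Q_\gamma:\mathbb{R}\to\mathbb{R}$ is defined by $Q_\gamma(x)=x+1$ if $x\le\gamma$ and $Q_\gamma(x)=1+s(1-x)$ if $x>\gamma$. Write $Q_\gamma^k(\gamma^{\pm}):=\lim_{x\to\gamma^{\pm}}Q_\gamma^k(x)$ and let $(Q_\gamma^k)'(\gamma^\pm)$ be the one-sided derivatives. $Q_\gamma$ satisfies the matching condition with matching exponents $\kappa^\pm$ (positive integers) if $Q_\gamma^{\kappa^-}(\gamma^-)=Q_\gamma^{\kappa^+}(\gamma^+)$ and $(Q_\gamma^{\kappa^-})'(\gamma^-)=(Q_\gamma^{\kappa^+})'(\gamma^+)$. The prematching set is $PM_\gamma:=\{Q_\gamma^j(\gamma^-):1\le j\le\kappa^--1\}\cup\{Q_\gamma^j(\gamma^+):1\le j\le\kappa^+-1\}$. The matching set is the (open) set of $\gamma\in\mathbb{R}$ such that $Q_\gamma$ satisfies the matching condition and $\gamma\notin PM_\gamma$; the bifurcation set $\mathcal{E}$ is its complement in $\mathbb{R}$. $HD$ denotes Hausdorff dimension. *)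

theory Defs
  imports "HOL-Analysis.Analysis"
begin

section \<open>Hausdorff measure and Hausdorff dimension\<close>

text \<open>
  The \<open>d\<close>-th power of the diameter, with the usual conventions that the empty set contributes
  \<open>0\<close> and, for \<open>d = 0\<close>, every non-empty set contributes \<open>1\<close>
  (note that \<open>0 powr 0 = 0\<close> in HOL).
\<close>

definition diam_pow :: "real \<Rightarrow> 'a::metric_space set \<Rightarrow> real" where
  "diam_pow d U = (if U = {} then 0 else if d = 0 then 1 else diameter U powr d)"

text \<open>Boundedness is required explicitly because \<^const>\<open>diameter\<close> is real-valued, hence
  meaningless on unbounded sets.\<close>

definition hausdorff_premeasure ::
    "real \<Rightarrow> real \<Rightarrow> 'a::metric_space set \<Rightarrow> ennreal" where
  "hausdorff_premeasure d \<epsilon> A =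
     Inf {(\<Sum>n. ennreal (diam_pow d (U n))) | U :: nat \<Rightarrow> 'a set.
            A \<subseteq> (\<Union>n. U n) \<and> (\<forall>n. bounded (U n) \<and> diameter (U n) \<le> \<epsilon>)}"

definition hausdorff_measure :: "real \<Rightarrow> 'a::metric_space set \<Rightarrow> ennreal" where
  "hausdorff_measure d A = (SUP \<epsilon>\<in>{0<..}. hausdorff_premeasure d \<epsilon> A)"

definition hausdorff_dim :: "'a::metric_space set \<Rightarrow> ennreal" where
  "hausdorff_dim A = Inf {ennreal d | d. 0 \<le> d \<and> hausdorff_measure d A = 0}"

section \<open>The family of maps, matching, and the bifurcation set\<close>

definition Q :: "real \<Rightarrow> real \<Rightarrow> real \<Rightarrow> real" where
  "Q s \<gamma> x = (if x \<le> \<gamma> then x + 1 else 1 + s * (1 - x))"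

definition orbit_left :: "real \<Rightarrow> real \<Rightarrow> nat \<Rightarrow> real" where
  "orbit_left s \<gamma> k = Lim (at_left \<gamma>) (Q s \<gamma> ^^ k)"

definition orbit_right :: "real \<Rightarrow> real \<Rightarrow> nat \<Rightarrow> real" where
  "orbit_right s \<gamma> k = Lim (at_right \<gamma>) (Q s \<gamma> ^^ k)"

text \<open>The iterates of \<^term>\<open>Q s \<gamma>\<close> may jump at \<open>\<gamma>\<close>; the one-sided derivatives at \<open>\<gamma>\<close> are therefore
  taken relative to the one-sided limits instead of the value at \<open>\<gamma>\<close>.\<close>

definition deriv_left :: "real \<Rightarrow> real \<Rightarrow> nat \<Rightarrow> real" where
  "deriv_left s \<gamma> k =
     Lim (at_left \<gamma>) (\<lambda>x. ((Q s \<gamma> ^^ k) x - orbit_left s \<gamma> k) / (x - \<gamma>))"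

definition deriv_right :: "real \<Rightarrow> real \<Rightarrow> nat \<Rightarrow> real" where
  "deriv_right s \<gamma> k =
     Lim (at_right \<gamma>) (\<lambda>x. ((Q s \<gamma> ^^ k) x - orbit_right s \<gamma> k) / (x - \<gamma>))"

definition matching :: "real \<Rightarrow> real \<Rightarrow> nat \<Rightarrow> nat \<Rightarrow> bool" where
  "matching s \<gamma> \<kappa>m \<kappa>p \<longleftrightarrow> 0 < \<kappa>m \<and> 0 < \<kappa>p \<and>
     orbit_left s \<gamma> \<kappa>m = orbit_right s \<gamma> \<kappa>p \<and>
     deriv_left s \<gamma> \<kappa>m = deriv_right s \<gamma> \<kappa>p"

definition prematching :: "real \<Rightarrow> real \<Rightarrow> nat \<Rightarrow> nat \<Rightarrow> real set" where
  "prematching s \<gamma> \<kappa>m \<kappa>p =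
     {orbit_left s \<gamma> j | j. 1 \<le> j \<and> j \<le> \<kappa>m - 1} \<union>
     {orbit_right s \<gamma> j | j. 1 \<le> j \<and> j \<le> \<kappa>p - 1}"

text \<open>For \<open>s > 1\<close> the pairs of matching exponents of a given parameter form a chain in the
  componentwise order, and \<^const>\<open>prematching\<close> grows along this chain.  The existential below
  hence defines the same set as insisting on the smallest pair of exponents.\<close>

definition matching_set :: "real \<Rightarrow> real set" where
  "matching_set s = {\<gamma>. \<exists>\<kappa>m \<kappa>p. matching s \<gamma> \<kappa>m \<kappa>p \<and> \<gamma> \<notin> prematching s \<gamma> \<kappa>m \<kappa>p}"

definition bifurcation_set :: "real \<Rightarrow> real set" where
  "bifurcation_set s = - matching_set s"

text \<open>All one-sided limits above exist: on each side of \<open>\<gamma>\<close> the iterates are eventually affine.\<close>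

lemma Q_iterate_affine:
  assumes "s \<noteq> 0" and "F = at_left \<gamma> \<or> F = at_right \<gamma>"
  shows "\<exists>a b. a \<noteq> 0 \<and> (\<forall>\<^sub>F x in F. (Q s \<gamma> ^^ k) x = a * x + b)"
proof (induction k)
  case 0
  show ?case by (rule exI[of _ 1], rule exI[of _ 0]) simp
next
  case (Suc k)
  then obtain a b where a: "a \<noteq> 0" and ev: "\<forall>\<^sub>F x in F. (Q s \<gamma> ^^ k) x = a * x + b"
    by blast
  have tends: "((\<lambda>x. a * x + b) \<longlongrightarrow> a * \<gamma> + b) F"
    using assms(2) by (auto intro!: tendsto_intros)
  have side: "(\<forall>\<^sub>F x in F. x < \<gamma>) \<or> (\<forall>\<^sub>F x in F. \<gamma> < x)"
    using assms(2) by (auto simp: eventually_at_filter)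
  have "(\<forall>\<^sub>F x in F. a * x + b \<le> \<gamma>) \<or> (\<forall>\<^sub>F x in F. \<gamma> < a * x + b)"
  proof (cases "a * \<gamma> + b" \<gamma> rule: linorder_cases)
    case less
    then show ?thesis using eventually_mono[OF order_tendstoD(2)[OF tends less]] by fastforce
  next
    case greater
    then show ?thesis using order_tendstoD(1)[OF tends greater] by blast
  next
    case equal
    have lt: "a * x + b \<le> \<gamma>" if "a < 0 \<and> \<gamma> < x \<or> 0 < a \<and> x < \<gamma>" for x
      using that equal mult_strict_left_mono[of x \<gamma> a] mult_strict_left_mono_neg[of \<gamma> x a] by linarith
    have gt: "\<gamma> < a * x + b" if "a < 0 \<and> x < \<gamma> \<or> 0 < a \<and> \<gamma> < x" for x
      using that equal mult_strict_left_mono[of \<gamma> x a] mult_strict_left_mono_neg[of x \<gamma> a] by linarith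
    from a consider "a < 0" | "0 < a" by linarith
    then show ?thesis
    proof cases
      case 1
      then show ?thesis using side by (metis (mono_tags, lifting) eventually_mono lt gt)
    next
      case 2
      then show ?thesis using side by (metis (mono_tags, lifting) eventually_mono lt gt)
    qed
  qed
  then show ?case
  proof
    assume "\<forall>\<^sub>F x in F. a * x + b \<le> \<gamma>"
    with ev have "\<forall>\<^sub>F x in F. (Q s \<gamma> ^^ Suc k) x = a * x + (b + 1)"
      by eventually_elim (simp add: Q_def)
    with a show ?thesis by blast
  next
    assume "\<forall>\<^sub>F x in F. \<gamma> < a * x + b"
    with ev have "\<forall>\<^sub>F x in F. (Q s \<gamma> ^^ Suc k) x = (- s * a) * x + (1 + s * (1 - b))"
      by eventually_elim (simp add: Q_def algebra_simps)
    moreover have "- s * a \<noteq> 0" using a assms(1) by simp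
    ultimately show ?thesis by blast
  qed
qed

end

theory Submission
  imports Defs
begin

text \<open>
  Modulo \<open>1\<close> the two branches of \<^const>\<open>Q\<close> are the identity and \<open>T x = - s * x\<close>, so both orbits of
  \<open>\<gamma>\<close> follow the \<open>T\<close>-orbit of \<open>\<gamma>\<close>, and after equally many passages through the second branch
  they have the same slope and differ by an integer.  The orbit which is lower climbs in unit steps
  until it enters \<open>(\<gamma>, \<gamma> + 1]\<close>.  It meets the upper orbit exactly if the upper one lies below
  \<open>\<gamma> + 1\<close>; otherwise both use the second branch next, and the roles are exchanged.  Tracking this
  competition shows that, for \<open>\<gamma> > 0\<close>, the bifurcation set is governed by the condition that no point
  \<open>(- s) ^ n * \<gamma>\<close> has its fractional part below \<open>\<gamma>\<close>: the weak inequality is necessary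
  (\<open>bifurcation_set_orbit_ge\<close>), the strict one for all \<open>n \<ge> 1\<close> is sufficient
  (\<open>orbit_greater_imp_bifurcation_set\<close>).  The parameters outside \<open>[0, s / (s + 1)]\<close> match after
  at most two passages.

  Upper bounds.  A parameter \<open>\<gamma> \<ge> \<delta>\<close> in the bifurcation set has an orbit that avoids \<open>[0, \<delta>)\<close>.  Hence
  its expansion in base \<open>b = s ^ (2 * N)\<close>, where \<open>1 / b \<le> \<delta>\<close>, never uses the digit \<open>0\<close>.  Such numbers are
  covered by \<open>(b - 1) ^ n\<close> intervals of length \<open>1 / b ^ n\<close>, which makes their dimension smaller than
  \<open>1\<close>; letting \<open>\<delta>\<close> tend to \<open>0\<close> yields measure zero.

  Lower bound.  In base \<open>B = s ^ N\<close> the numbers with digits in \<open>1, \<dots>, B - 2\<close> form a Cantor set of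
  dimension \<open>log B (B - 2)\<close>, which tends to \<open>1\<close> as \<open>N\<close> grows, and their orbits under \<open>T\<close> stay at distance
  at least \<open>1 / s ^ (2 * N)\<close> from the integers.  Multiplied by \<open>1 / s ^ (2 * N + 2)\<close> such a number becomes
  smaller than everything its orbit visits later, so the scaled Cantor set lies in the bifurcation
  set.  Its Hausdorff measure is bounded below by transporting Lebesgue measure: the map
  that reads the digits as a base \<open>B - 2\<close> expansion is Hoelder continuous and covers an interval.
\<close>

section \<open>Germs of the iterates at the discontinuity\<close>

text \<open>
  Near \<open>\<gamma>\<close>, along the filter \<open>F\<close> of one of its sides, the \<open>k\<close>-th iterate is affine with limit \<open>u\<close> and
  with a slope that counts the \<open>n\<close> uses of the second branch.  The last conjunct says that the
  one-sided orbit has not hit \<open>\<gamma>\<close> before time \<open>k\<close>; this is how prematching sets enter.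
\<close>
definition branch :: "real \<Rightarrow> real \<Rightarrow> real filter \<Rightarrow> nat \<Rightarrow> nat \<Rightarrow> real \<Rightarrow> bool" where
  "branch s \<gamma> F k n u \<longleftrightarrow> 0 < k \<and>
     (\<forall>\<^sub>F x in F. (Q s \<gamma> ^^ k) x = (- s) ^ n * (x - \<gamma>) + u) \<and>
     (\<forall>j. 1 \<le> j \<and> j < k \<longrightarrow> Lim F (Q s \<gamma> ^^ j) \<noteq> \<gamma>)"

definition one_sided :: "real \<Rightarrow> real filter \<Rightarrow> bool" where
  "one_sided \<gamma> F \<longleftrightarrow> F = at_left \<gamma> \<or> F = at_right \<gamma>"

lemma one_sided_nontrivial: "one_sided \<gamma> F \<Longrightarrow> F \<noteq> bot"
  using trivial_limit_at_left_real[of \<gamma>] trivial_limit_at_right_real[of \<gamma>]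
  by (metis one_sided_def)

lemma one_sided_le_at: "one_sided \<gamma> F \<Longrightarrow> F \<le> at \<gamma>"
  by (auto simp: one_sided_def intro: at_le)

lemma at_right_neq_at_left: "at_right (\<gamma>::real) \<noteq> at_left \<gamma>"
proof
  assume eq: "at_right \<gamma> = at_left \<gamma>"
  have "\<forall>\<^sub>F x in at_left \<gamma>. x < \<gamma>" by (simp add: eventually_at_filter)
  moreover have "\<forall>\<^sub>F x in at_left \<gamma>. \<gamma> < x"
    unfolding eq[symmetric] by (simp add: eventually_at_filter)
  ultimately have "\<forall>\<^sub>F x in at_left \<gamma>. False" by eventually_elim simp
  then show False by simp
qed

lemma affine_tendsto_one_sided:
  assumes "one_sided \<gamma> F"
  shows "((\<lambda>x. a * (x - \<gamma>) + u) \<longlongrightarrow> u) F"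
proof -
  have "((\<lambda>x. a * (x - \<gamma>) + u) \<longlongrightarrow> a * (\<gamma> - \<gamma>) + u) (at \<gamma>)"
    by (intro tendsto_intros)
  then show ?thesis using tendsto_mono[OF one_sided_le_at[OF assms]] by simp
qed

lemma branch_tendsto:
  assumes "one_sided \<gamma> F" "branch s \<gamma> F k n u"
  shows "((Q s \<gamma> ^^ k) \<longlongrightarrow> u) F"
  using assms tendsto_cong[of "Q s \<gamma> ^^ k" "\<lambda>x. (- s) ^ n * (x - \<gamma>) + u" F u]
    affine_tendsto_one_sided[OF assms(1)] by (auto simp: branch_def)

lemma branch_Lim:
  assumes "one_sided \<gamma> F" "branch s \<gamma> F k n u"
  shows "Lim F (Q s \<gamma> ^^ k) = u"
  using tendsto_Lim[OF one_sided_nontrivial branch_tendsto] assms by blast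

lemma branch_slope:
  assumes F: "one_sided \<gamma> F" and b: "branch s \<gamma> F k n u"
  shows "Lim F (\<lambda>x. ((Q s \<gamma> ^^ k) x - u) / (x - \<gamma>)) = (- s) ^ n"
proof (rule tendsto_Lim[OF one_sided_nontrivial[OF F]])
  have ne: "\<forall>\<^sub>F x in F. x \<noteq> \<gamma>"
    using F by (auto simp: one_sided_def eventually_at_filter)
  have "\<forall>\<^sub>F x in F. (Q s \<gamma> ^^ k) x = (- s) ^ n * (x - \<gamma>) + u"
    using b by (simp add: branch_def)
  with ne have "\<forall>\<^sub>F x in F. ((Q s \<gamma> ^^ k) x - u) / (x - \<gamma>) = (- s) ^ n"
    by eventually_elim simp
  then show "((\<lambda>x. ((Q s \<gamma> ^^ k) x - u) / (x - \<gamma>)) \<longlongrightarrow> (- s) ^ n) F"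
    by (rule tendsto_eventually)
qed

lemma branch_step_low:
  assumes F: "one_sided \<gamma> F" and b: "branch s \<gamma> F k n u" and u: "u < \<gamma>"
  shows "branch s \<gamma> F (Suc k) n (u + 1)"
proof -
  have "\<forall>\<^sub>F x in F. (Q s \<gamma> ^^ k) x < \<gamma>"
    using order_tendstoD(2)[OF branch_tendsto[OF F b] u] .
  moreover have "\<forall>\<^sub>F x in F. (Q s \<gamma> ^^ k) x = (- s) ^ n * (x - \<gamma>) + u"
    using b by (simp add: branch_def)
  ultimately have "\<forall>\<^sub>F x in F. (Q s \<gamma> ^^ Suc k) x = (- s) ^ n * (x - \<gamma>) + (u + 1)"
    by eventually_elim (simp add: Q_def)
  then show ?thesis using b branch_Lim[OF F b] u
    by (auto simp: branch_def less_Suc_eq)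
qed

lemma branch_step_high:
  assumes F: "one_sided \<gamma> F" and b: "branch s \<gamma> F k n u" and u: "\<gamma> < u"
  shows "branch s \<gamma> F (Suc k) (Suc n) (1 + s * (1 - u))"
proof -
  have "\<forall>\<^sub>F x in F. \<gamma> < (Q s \<gamma> ^^ k) x"
    using order_tendstoD(1)[OF branch_tendsto[OF F b] u] .
  moreover have "\<forall>\<^sub>F x in F. (Q s \<gamma> ^^ k) x = (- s) ^ n * (x - \<gamma>) + u"
    using b by (simp add: branch_def)
  ultimately have "\<forall>\<^sub>F x in F. (Q s \<gamma> ^^ Suc k) x
      = (- s) ^ Suc n * (x - \<gamma>) + (1 + s * (1 - u))"
  proof eventually_elim
    case (elim x)
    have "(Q s \<gamma> ^^ Suc k) x = 1 + s * (1 - (Q s \<gamma> ^^ k) x)"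
      using elim(1) by (simp add: Q_def)
    then show ?case unfolding elim(2) by (simp add: algebra_simps)
  qed
  then show ?thesis using b branch_Lim[OF F b] u
    by (auto simp: branch_def less_Suc_eq)
qed

lemma branch_climb:
  assumes F: "one_sided \<gamma> F" and b: "branch s \<gamma> F k n u" and u: "u + real m < \<gamma> + 1"
  shows "\<exists>k'. branch s \<gamma> F k' n (u + real m)"
  using u
proof (induction m)
  case 0
  then show ?case using b by auto
next
  case (Suc m)
  then obtain k' where "branch s \<gamma> F k' n (u + real m)" by auto
  from branch_step_low[OF F this] Suc.prems show ?case by (auto simp: add_ac)
qed

lemma branch_start_left: "branch s \<gamma> (at_left \<gamma>) 1 0 (\<gamma> + 1)"
proof -
  have "\<forall>\<^sub>F x in at_left \<gamma>. x < \<gamma>" by (simp add: eventually_at_filter)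
  then have "\<forall>\<^sub>F x in at_left \<gamma>. (Q s \<gamma> ^^ 1) x = (- s) ^ 0 * (x - \<gamma>) + (\<gamma> + 1)"
    by eventually_elim (simp add: Q_def)
  then show ?thesis by (auto simp: branch_def)
qed

lemma branch_start_right: "branch s \<gamma> (at_right \<gamma>) 1 1 (1 + s * (1 - \<gamma>))"
proof -
  have "\<forall>\<^sub>F x in at_right \<gamma>. \<gamma> < x" by (simp add: eventually_at_filter)
  then have "\<forall>\<^sub>F x in at_right \<gamma>. (Q s \<gamma> ^^ 1) x = (- s) ^ 1 * (x - \<gamma>) + (1 + s * (1 - \<gamma>))"
    by eventually_elim (simp add: Q_def algebra_simps)
  then show ?thesis by (auto simp: branch_def)
qed

lemma branch_left_second: "branch s \<gamma> (at_left \<gamma>) 2 1 (1 - s * \<gamma>)"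
  using branch_step_high[OF _ branch_start_left, of \<gamma> s]
  by (simp add: one_sided_def numeral_2_eq_2)

section \<open>When the two orbits meet\<close>

text \<open>Equal \<open>n\<close> means equal slopes, and the orbits recorded in \<^const>\<open>branch\<close> have not visited \<open>\<gamma>\<close>.\<close>
lemma meeting_imp_matching_set:
  assumes L: "branch s \<gamma> (at_left \<gamma>) k n u" and R: "branch s \<gamma> (at_right \<gamma>) k' n u"
  shows "\<gamma> \<in> matching_set s"
proof -
  have l: "one_sided \<gamma> (at_left \<gamma>)" and r: "one_sided \<gamma> (at_right \<gamma>)"
    by (simp_all add: one_sided_def)
  have "orbit_left s \<gamma> k = u" "orbit_right s \<gamma> k' = u"
    using branch_Lim[OF l L] branch_Lim[OF r R] by (simp_all add: orbit_left_def orbit_right_def)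
  moreover from this have "deriv_left s \<gamma> k = (- s) ^ n" "deriv_right s \<gamma> k' = (- s) ^ n"
    using branch_slope[OF l L] branch_slope[OF r R]
    by (simp_all add: deriv_left_def deriv_right_def)
  ultimately have "matching s \<gamma> k k'"
    using L R by (simp add: matching_def branch_def)
  moreover have "\<gamma> \<notin> prematching s \<gamma> k k'"
    using L R by (fastforce simp: prematching_def branch_def orbit_left_def orbit_right_def)
  ultimately show ?thesis by (auto simp: matching_set_def)
qed

text \<open>The lower of the two values climbs by unit steps through points below \<open>\<gamma>\<close> until it reaches the
  other one.  The strict bound \<open>\<gamma> + 1\<close> ensures that \<open>\<gamma>\<close> itself is not met on the way.\<close>
lemma congruent_below_imp_matching_set:
  assumes L: "branch s \<gamma> (at_left \<gamma>) k n u" and R: "branch s \<gamma> (at_right \<gamma>) k' n v"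
    and int: "u - v \<in> \<int>" and u: "u < \<gamma> + 1" and v: "v < \<gamma> + 1"
  shows "\<gamma> \<in> matching_set s"
proof -
  have l: "one_sided \<gamma> (at_left \<gamma>)" and r: "one_sided \<gamma> (at_right \<gamma>)"
    by (simp_all add: one_sided_def)
  from int obtain z :: int where z: "u - v = of_int z" by (auto elim: Ints_cases)
  show ?thesis
  proof (cases "z \<ge> 0")
    case True
    then have e: "v + real (nat z) = u" using z by simp
    with branch_climb[OF r R, of "nat z"] u L show ?thesis
      by (auto intro: meeting_imp_matching_set)
  next
    case False
    then have e: "u + real (nat (- z)) = v" using z by simp
    with branch_climb[OF l L, of "nat (- z)"] v R show ?thesis
      by (auto intro: meeting_imp_matching_set)
  qed
qed

text \<open>For \<open>\<gamma> > s / (s + 1)\<close> the first values behind the second branch, \<open>1 - s * \<gamma>\<close> and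
  \<open>1 + s * (1 - \<gamma>)\<close>, already lie below \<open>\<gamma> + 1\<close>.  For \<open>\<gamma> < 0\<close> both lie above \<open>\<gamma>\<close>, and the second
  branch maps them to values below \<open>\<gamma> + 1\<close>, since \<open>s\<^sup>2 * \<gamma> < \<gamma>\<close>.\<close>
lemma bifurcation_set_subset:
  assumes s: "s \<ge> 2"
  shows "bifurcation_set (real s) \<subseteq> {0 .. real s / (real s + 1)}"
proof
  fix \<gamma> assume "\<gamma> \<in> bifurcation_set (real s)"
  then have nm: "\<gamma> \<notin> matching_set (real s)" by (simp add: bifurcation_set_def)
  let ?s = "real s"
  have l: "one_sided \<gamma> (at_left \<gamma>)" and r: "one_sided \<gamma> (at_right \<gamma>)"
    by (simp_all add: one_sided_def)
  have "0 \<le> \<gamma>"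
  proof (rule ccontr)
    assume "\<not> 0 \<le> \<gamma>"
    then have g: "\<gamma> < 0" by simp
    have sg: "?s * \<gamma> < 0" using g s by (simp add: mult_less_0_iff)
    have sq: "?s * (?s * \<gamma>) < \<gamma>"
    proof -
      have "?s * (?s * \<gamma>) < 1 * (?s * \<gamma>)"
        using sg s by (intro mult_strict_right_mono_neg) auto
      also have "\<dots> < 1 * \<gamma>" using g s by simp
      finally show ?thesis by simp
    qed
    have "\<gamma> < 1 - ?s * \<gamma>" using g sg by simp
    from branch_step_high[OF l branch_left_second this]
    have L: "branch ?s \<gamma> (at_left \<gamma>) (Suc 2) (Suc 1) (1 + ?s * (?s * \<gamma>))" by simp
    have "\<gamma> < 1 + ?s * (1 - \<gamma>)" using g sg s by (simp add: algebra_simps)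
    from branch_step_high[OF r branch_start_right this]
    have R: "branch ?s \<gamma> (at_right \<gamma>) (Suc 1) (Suc 1) (1 + ?s * (?s * \<gamma>) - ?s * ?s)"
      by (simp add: algebra_simps)
    have "1 + ?s * (?s * \<gamma>) - (1 + ?s * (?s * \<gamma>) - ?s * ?s) \<in> \<int>" by simp
    moreover have "0 \<le> ?s * ?s" by simp
    then have "1 + ?s * (?s * \<gamma>) - ?s * ?s < \<gamma> + 1" using sq by linarith
    ultimately show False
      using congruent_below_imp_matching_set[OF L R] sq nm by simp
  qed
  moreover have "\<gamma> \<le> ?s / (?s + 1)"
  proof (rule ccontr)
    assume "\<not> \<gamma> \<le> ?s / (?s + 1)"
    then have "?s < \<gamma> * (?s + 1)" by (simp add: not_le divide_less_eq)
    then have g: "1 + ?s * (1 - \<gamma>) < \<gamma> + 1" by (simp add: algebra_simps)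
    have "1 - ?s * \<gamma> - (1 + ?s * (1 - \<gamma>)) = - real s" by (simp add: algebra_simps)
    then have "1 - ?s * \<gamma> - (1 + ?s * (1 - \<gamma>)) \<in> \<int>" by simp
    moreover have "1 - ?s * \<gamma> < \<gamma> + 1" using g by (simp add: algebra_simps)
    ultimately show False
      using congruent_below_imp_matching_set[OF branch_left_second branch_start_right _ _ g] nm
      by blast
  qed
  ultimately show "\<gamma> \<in> {0 .. ?s / (?s + 1)}" by simp
qed

section \<open>Arithmetic of the bifurcation set\<close>

lemma frac_eqI_Ints: "x - y \<in> \<int> \<Longrightarrow> frac x = frac (y :: real)"
  by (metis frac_eq_0_iff frac_diff_zero)

text \<open>
  The competition between the orbits right after both have used the second branch for the \<open>n\<close>-th
  time: \<open>w\<close> is the point from which the then lower orbit jumped, so its image is now the upper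
  one.  The other orbit was an integer number of units above \<open>w\<close>, hence it is now lower by an integral
  \<open>m \<ge> s\<close>.  The side of \<open>\<gamma>\<close> that is ahead alternates, which is why \<open>F\<close> and \<open>G\<close> are not fixed.
\<close>
definition stage :: "real \<Rightarrow> real \<Rightarrow> nat \<Rightarrow> real \<Rightarrow> bool" where
  "stage s \<gamma> n w \<longleftrightarrow> (\<exists>F G k k' m. (F = at_left \<gamma> \<and> G = at_right \<gamma> \<or> F = at_right \<gamma> \<and> G = at_left \<gamma>) \<and>
     m \<in> \<int> \<and> s \<le> m \<and>
     branch s \<gamma> F k n (1 + s * (1 - w)) \<and> branch s \<gamma> G k' n (1 + s * (1 - w) - m))"

text \<open>If the upper value lay below \<open>\<gamma> + 1\<close>, the lower orbit would catch up with it.\<close>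
lemma stage_bound:
  assumes s: "s \<ge> 2" and st: "stage (real s) \<gamma> n w" and nm: "\<gamma> \<notin> matching_set (real s)"
  shows "\<gamma> \<le> real s * (1 - w)"
proof (rule ccontr)
  assume "\<not> ?thesis"
  then have U: "1 + real s * (1 - w) < \<gamma> + 1" by simp
  from st obtain F G k k' m where
    FG: "F = at_left \<gamma> \<and> G = at_right \<gamma> \<or> F = at_right \<gamma> \<and> G = at_left \<gamma>" and
    m: "m \<in> \<int>" "real s \<le> m" and
    bF: "branch (real s) \<gamma> F k n (1 + real s * (1 - w))" and
    bG: "branch (real s) \<gamma> G k' n (1 + real s * (1 - w) - m)"
    unfolding stage_def by blast
  have U': "1 + real s * (1 - w) - m < \<gamma> + 1" using U m by simp
  from FG have "\<gamma> \<in> matching_set (real s)"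
  proof
    assume "F = at_left \<gamma> \<and> G = at_right \<gamma>"
    then show ?thesis
      using congruent_below_imp_matching_set[OF _ _ _ U U'] bF bG m by simp
  next
    assume "F = at_right \<gamma> \<and> G = at_left \<gamma>"
    then show ?thesis
      using congruent_below_imp_matching_set[OF _ _ _ U' U] bF bG m by simp
  qed
  with nm show False by simp
qed

text \<open>The lower orbit climbs to the representative \<open>w'\<close> of its class modulo \<open>1\<close> in \<open>(\<gamma>, \<gamma> + 1)\<close>, which
  stays below the upper orbit because the latter is at least \<open>\<gamma> + 1\<close> when there is no matching.
  The assumption that \<open>- s * w\<close> and \<open>\<gamma>\<close> are incongruent modulo \<open>1\<close> prevents the climb from hitting \<open>\<gamma>\<close>.\<close>
lemma stage_step:
  assumes s: "s \<ge> 2" and g: "0 < \<gamma>" and st: "stage (real s) \<gamma> n w" and w: "\<gamma> \<le> w"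
    and nm: "\<gamma> \<notin> matching_set (real s)" and ni: "- real s * w - \<gamma> \<notin> \<int>"
  shows "\<exists>w'. stage (real s) \<gamma> (Suc n) w' \<and> \<gamma> < w' \<and> w' + real s * w \<in> \<int>"
proof -
  let ?s = "real s"
  define U where "U = 1 + ?s * (1 - w)"
  from st obtain F G k k' m where
    FG: "F = at_left \<gamma> \<and> G = at_right \<gamma> \<or> F = at_right \<gamma> \<and> G = at_left \<gamma>" and
    m: "m \<in> \<int>" "?s \<le> m" and
    bF: "branch ?s \<gamma> F k n U" and bG: "branch ?s \<gamma> G k' n (U - m)"
    unfolding stage_def U_def by blast
  have F: "one_sided \<gamma> F" and G: "one_sided \<gamma> G" using FG by (auto simp: one_sided_def)
  from m obtain z :: int where z: "m = of_int z" by (auto elim: Ints_cases)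
  have Ui: "U + ?s * w \<in> \<int>" unfolding U_def by (simp add: algebra_simps)
  have U\<gamma>: "U - \<gamma> \<notin> \<int>"
  proof
    assume "U - \<gamma> \<in> \<int>"
    then have "U - \<gamma> - (U + ?s * w) \<in> \<int>" using Ui by (rule Ints_diff)
    also have "U - \<gamma> - (U + ?s * w) = - ?s * w - \<gamma>" by simp
    finally show False using ni by contradiction
  qed
  have U1: "1 \<le> U - \<gamma>" using stage_bound[OF s st nm] by (simp add: U_def)
  define w' where "w' = \<gamma> + frac (U - \<gamma>)"
  have w'1: "\<gamma> < w'" "w' < \<gamma> + 1"
    using U\<gamma> frac_ge_0[of "U - \<gamma>"] frac_lt_1[of "U - \<gamma>"] frac_eq_0_iff[of "U - \<gamma>"]
    unfolding w'_def by linarith+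
  have w'2: "w' = U - of_int \<lfloor>U - \<gamma>\<rfloor>" unfolding w'_def frac_def by simp
  have "U - m \<le> 1"
  proof -
    have "0 \<le> ?s * w" using w g by simp
    moreover have "U - m = 1 + ?s - ?s * w - m" by (simp add: U_def right_diff_distrib)
    ultimately show ?thesis using m by linarith
  qed
  then have "U - m - \<gamma> < 1" using g by simp
  then have "\<lfloor>U - \<gamma>\<rfloor> - z \<le> 0"
    using z by linarith
  then have e: "U - m + real (nat (z - \<lfloor>U - \<gamma>\<rfloor>)) = w'"
    using z w'2 by simp
  obtain k'' where "branch ?s \<gamma> G k'' n w'"
    using branch_climb[OF G bG, of "nat (z - \<lfloor>U - \<gamma>\<rfloor>)"] e w'1 by auto
  from branch_step_high[OF G this w'1(1)]
  have A: "branch ?s \<gamma> G (Suc k'') (Suc n) (1 + ?s * (1 - w'))" .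
  have "\<gamma> < U" using U1 by simp
  from branch_step_high[OF F bF this]
  have B: "branch ?s \<gamma> F (Suc k) (Suc n) (1 + ?s * (1 - w') - ?s * of_int \<lfloor>U - \<gamma>\<rfloor>)"
    by (simp add: w'2 algebra_simps)
  have "1 \<le> \<lfloor>U - \<gamma>\<rfloor>" using U1 by (simp add: le_floor_iff)
  then have "?s * 1 \<le> ?s * of_int \<lfloor>U - \<gamma>\<rfloor>"
    by (intro mult_left_mono) auto
  then have "stage ?s \<gamma> (Suc n) w'"
    unfolding stage_def using FG A B
    by (intro exI[of _ G] exI[of _ F] exI[of _ "Suc k''"] exI[of _ "Suc k"]
        exI[of _ "?s * of_int \<lfloor>U - \<gamma>\<rfloor>"]) auto
  moreover have "w' + ?s * w \<in> \<int>"
  proof -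
    have eq: "w' + ?s * w = (U + ?s * w) - of_int \<lfloor>U - \<gamma>\<rfloor>" using w'2 by simp
    show ?thesis unfolding eq using Ui by (rule Ints_diff) simp
  qed
  ultimately show ?thesis using w'1 by blast
qed

text \<open>At the beginning the right orbit behaves as if it had jumped from \<open>w = \<gamma>\<close> itself.\<close>
lemma stage_reached:
  assumes s: "s \<ge> 2" and g: "0 < \<gamma>" and nm: "\<gamma> \<notin> matching_set (real s)"
    and ni: "\<And>j. 1 \<le> j \<Longrightarrow> j \<le> n \<Longrightarrow> (- real s) ^ j * \<gamma> - \<gamma> \<notin> \<int>"
  shows "\<exists>w. stage (real s) \<gamma> (Suc n) w \<and> \<gamma> \<le> w \<and> w - (- real s) ^ n * \<gamma> \<in> \<int>"
  using ni
proof (induction n)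
  case 0
  have "stage (real s) \<gamma> (Suc 0) \<gamma>"
    unfolding stage_def
    using branch_start_right[of "real s" \<gamma>] branch_left_second[of "real s" \<gamma>]
    by (intro exI[of _ "at_right \<gamma>"] exI[of _ "at_left \<gamma>"] exI[of _ 1] exI[of _ 2]
        exI[of _ "real s"]) (auto simp: algebra_simps)
  then show ?case by (intro exI[of _ \<gamma>]) simp
next
  case (Suc n)
  then obtain w where w: "stage (real s) \<gamma> (Suc n) w" "\<gamma> \<le> w" "w - (- real s) ^ n * \<gamma> \<in> \<int>"
    by (metis le_SucI)
  have i: "- real s * (w - (- real s) ^ n * \<gamma>) \<in> \<int>" using w(3) by (intro Ints_mult) auto
  have "- real s * w - \<gamma> \<notin> \<int>"
  proof
    assume "- real s * w - \<gamma> \<in> \<int>"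
    from Ints_diff[OF this i]
    have "- real s * w - \<gamma> - (- real s * (w - (- real s) ^ n * \<gamma>)) \<in> \<int>" .
    also have "- real s * w - \<gamma> - (- real s * (w - (- real s) ^ n * \<gamma>))
        = (- real s) ^ Suc n * \<gamma> - \<gamma>" by (simp add: algebra_simps)
    finally have "(- real s) ^ Suc n * \<gamma> - \<gamma> \<in> \<int>" .
    with Suc.prems[of "Suc n"] show False by simp
  qed
  from stage_step[OF s g w(1,2) nm this]
  obtain w' where w': "stage (real s) \<gamma> (Suc (Suc n)) w'" "\<gamma> < w'" "w' + real s * w \<in> \<int>" by blast
  have "w' - (- real s) ^ Suc n * \<gamma> \<in> \<int>"
    using Ints_add[OF w'(3) i] by (simp add: algebra_simps)
  with w' show ?case by (intro exI[of _ w']) auto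
qed

text \<open>
  Without matching, \<open>stage_bound\<close> forces the representative \<open>w\<close> of \<open>(- s) ^ n * \<gamma>\<close> above \<open>\<gamma>\<close> to
  be smaller than \<open>1\<close>, so \<open>w\<close> is the fractional part.  This breaks down once the orbit
  has returned to \<open>\<gamma>\<close> modulo \<open>1\<close>; but then it is periodic, and the inequality is inherited from an
  earlier time.
\<close>
lemma bifurcation_set_orbit_ge:
  assumes s: "s \<ge> 2" and g: "0 < \<gamma>" and E: "\<gamma> \<in> bifurcation_set (real s)"
  shows "\<gamma> \<le> frac ((- real s) ^ n * \<gamma>)"
proof (induction n rule: less_induct)
  case (less n)
  let ?s = "real s"
  have nm: "\<gamma> \<notin> matching_set ?s" using E by (simp add: bifurcation_set_def)
  have "\<gamma> \<le> ?s / (?s + 1)" using bifurcation_set_subset[OF s] E by auto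
  also have "\<dots> < 1" by simp
  finally have g1: "\<gamma> < 1" .
  show ?case
  proof (cases "\<exists>j. 1 \<le> j \<and> j \<le> n \<and> (- ?s) ^ j * \<gamma> - \<gamma> \<in> \<int>")
    case True
    then obtain j where j: "1 \<le> j" "j \<le> n" "(- ?s) ^ j * \<gamma> - \<gamma> \<in> \<int>" by blast
    have "(- ?s) ^ (n - j) * ((- ?s) ^ j * \<gamma> - \<gamma>) \<in> \<int>"
      using j(3) by (intro Ints_mult Ints_power) auto
    also have "(- ?s) ^ (n - j) * ((- ?s) ^ j * \<gamma> - \<gamma>) = (- ?s) ^ n * \<gamma> - (- ?s) ^ (n - j) * \<gamma>"
      using j(2) by (simp add: right_diff_distrib flip: power_add mult.assoc)
    finally have "frac ((- ?s) ^ n * \<gamma>) = frac ((- ?s) ^ (n - j) * \<gamma>)" by (rule frac_eqI_Ints)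
    with less.IH[of "n - j"] j show ?thesis by simp
  next
    case False
    then obtain w where w: "stage ?s \<gamma> (Suc n) w" "\<gamma> \<le> w" "w - (- ?s) ^ n * \<gamma> \<in> \<int>"
      using stage_reached[OF s g nm, of n] by blast
    have "0 < ?s * (1 - w)" using stage_bound[OF s w(1) nm] g by simp
    then have "w < 1" using s by (simp add: zero_less_mult_iff)
    then have "frac w = w" using w(2) g by (simp add: frac_eq)
    with frac_eqI_Ints[OF w(3)] w(2) show ?thesis by simp
  qed
qed

text \<open>
  The invariant behind sufficiency.  The left orbit is the upper one, at height at least \<open>\<gamma> + 1\<close>,
  for even \<open>n\<close> and climbs below \<open>\<gamma> + 1\<close> for odd \<open>n\<close>; for the right orbit the parities are exchanged.
  So the two never agree while they have the same slope.
\<close>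
lemma nonmatching_branches:
  assumes s: "s \<ge> 2" and g: "0 < \<gamma>" "\<gamma> < 1"
    and orb: "\<And>n. n \<ge> 1 \<Longrightarrow> \<gamma> < frac ((- real s) ^ n * \<gamma>)"
    and F: "one_sided \<gamma> F" and k: "k \<ge> 1"
  shows "\<exists>n u. branch (real s) \<gamma> F k n u \<and> u - (- real s) ^ n * \<gamma> \<in> \<int> \<and>
    (if even n \<longleftrightarrow> F = at_left \<gamma> then \<gamma> + 1 \<le> u else 1 \<le> n \<and> u < \<gamma> + 1)"
  using k
proof (induction k rule: dec_induct)
  let ?s = "real s"
  note diff = at_right_neq_at_left
  \<comment> \<open>If a point \<open>u < 1\<close> of the orbit were too close to \<open>1\<close>, its image would have a fractional part in
    \<open>(0, \<gamma>]\<close>.\<close>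
  have upper: "\<gamma> < ?s * (1 - u)" if u: "u < 1" and i: "u - (- ?s) ^ n * \<gamma> \<in> \<int>" for n u
  proof (rule ccontr)
    assume n: "\<not> ?thesis"
    have i': "- ?s * (u - (- ?s) ^ n * \<gamma>) \<in> \<int>" using i by (intro Ints_mult) auto
    have "?s + - ?s * (u - (- ?s) ^ n * \<gamma>) \<in> \<int>" using i' by (intro Ints_add) auto
    then have "?s * (1 - u) - (- ?s) ^ Suc n * \<gamma> \<in> \<int>" by (simp add: algebra_simps)
    then have "frac (?s * (1 - u)) = frac ((- ?s) ^ Suc n * \<gamma>)" by (rule frac_eqI_Ints)
    moreover have "frac (?s * (1 - u)) = ?s * (1 - u)"
      using n u g by (simp add: frac_eq)
    ultimately show False using orb[of "Suc n"] n by simp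
  qed
  {
    case base
    from F show ?case unfolding one_sided_def
    proof
      assume "F = at_left \<gamma>"
      then show ?thesis using branch_start_left[of ?s \<gamma>]
        by (intro exI[of _ 0] exI[of _ "\<gamma> + 1"]) simp
    next
      assume F: "F = at_right \<gamma>"
      have "\<gamma> < ?s * (1 - \<gamma>)" using upper[of \<gamma> 0] g by simp
      with F show ?thesis using branch_start_right[of ?s \<gamma>] diff
        by (intro exI[of _ 1] exI[of _ "1 + ?s * (1 - \<gamma>)"]) (auto simp: algebra_simps)
    qed
  next
    case (step k)
    then obtain n u where b: "branch ?s \<gamma> F k n u" and i: "u - (- ?s) ^ n * \<gamma> \<in> \<int>"
      and c: "if even n \<longleftrightarrow> F = at_left \<gamma> then \<gamma> + 1 \<le> u else 1 \<le> n \<and> u < \<gamma> + 1" by blast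
    have "1 + ?s + - ?s * (u - (- ?s) ^ n * \<gamma>) \<in> \<int>"
      using i by (intro Ints_add Ints_mult) auto
    then have i': "1 + ?s * (1 - u) - (- ?s) ^ Suc n * \<gamma> \<in> \<int>" by (simp add: algebra_simps)
    show ?case
    proof (cases "even n \<longleftrightarrow> F = at_left \<gamma>")
      case True
      then have u: "\<gamma> + 1 \<le> u" using c by simp
      have "?s * (1 - u) \<le> 0" using u g by (simp add: mult_nonneg_nonpos)
      then have "1 + ?s * (1 - u) < \<gamma> + 1" using g by simp
      moreover have "branch ?s \<gamma> F (Suc k) (Suc n) (1 + ?s * (1 - u))"
        using branch_step_high[OF F b] u by simp
      ultimately show ?thesis using True i'
        by (intro exI[of _ "Suc n"] exI[of _ "1 + ?s * (1 - u)"]) auto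
    next
      case False
      then have u: "1 \<le> n" "u < \<gamma> + 1" using c by auto
      have fr: "frac u = frac ((- ?s) ^ n * \<gamma>)" using i by (rule frac_eqI_Ints)
      have "frac \<gamma> = \<gamma>" using g by (simp add: frac_eq)
      then have "u \<noteq> \<gamma>" using orb[OF u(1)] fr by auto
      then consider "u < \<gamma>" | "\<gamma> < u" by linarith
      then show ?thesis
      proof cases
        case 1
        have "u + 1 - (- ?s) ^ n * \<gamma> \<in> \<int>" using Ints_add[OF i Ints_1] by (simp add: algebra_simps)
        with branch_step_low[OF F b 1] False u 1 show ?thesis
          by (intro exI[of _ n] exI[of _ "u + 1"]) auto
      next
        case 2
        have "u < 1"
        proof (rule ccontr)
          assume "\<not> u < 1"
          then have "frac u = u - 1" using u g by (subst frac_unique_iff) auto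
          then show False using fr orb[OF u(1)] u by simp
        qed
        from upper[OF this i] have "\<gamma> + 1 \<le> 1 + ?s * (1 - u)" by simp
        with branch_step_high[OF F b 2] False i' show ?thesis
          by (intro exI[of _ "Suc n"] exI[of _ "1 + ?s * (1 - u)"]) auto
      qed
    qed
  }
qed

text \<open>Equal slopes force equal \<open>n\<close>, and for equal \<open>n\<close> one orbit is at or above \<open>\<gamma> + 1\<close> and the other
  one below it.\<close>
lemma orbit_greater_imp_bifurcation_set:
  assumes s: "s \<ge> 2" and g: "0 < \<gamma>" "\<gamma> < 1"
    and orb: "\<And>n. n \<ge> 1 \<Longrightarrow> \<gamma> < frac ((- real s) ^ n * \<gamma>)"
  shows "\<gamma> \<in> bifurcation_set (real s)"
proof -
  let ?s = "real s"
  have False if m: "matching ?s \<gamma> k k'" for k k'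
  proof -
    have k: "k \<ge> 1" "k' \<ge> 1" using m by (auto simp: matching_def)
    have l: "one_sided \<gamma> (at_left \<gamma>)" and r: "one_sided \<gamma> (at_right \<gamma>)"
      by (simp_all add: one_sided_def)
    note diff = at_right_neq_at_left
    obtain n u where L: "branch ?s \<gamma> (at_left \<gamma>) k n u"
      and Lc: "if even n then \<gamma> + 1 \<le> u else u < \<gamma> + 1"
      using nonmatching_branches[OF s g orb l k(1)] by auto
    obtain n' u' where R: "branch ?s \<gamma> (at_right \<gamma>) k' n' u'"
      and Rc: "if even n' then u' < \<gamma> + 1 else \<gamma> + 1 \<le> u'"
      using nonmatching_branches[OF s g orb r k(2)] diff by (auto split: if_splits)
    have o: "orbit_left ?s \<gamma> k = u" "orbit_right ?s \<gamma> k' = u'"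
      using branch_Lim[OF l L] branch_Lim[OF r R] by (simp_all add: orbit_left_def orbit_right_def)
    then have "deriv_left ?s \<gamma> k = (- ?s) ^ n" "deriv_right ?s \<gamma> k' = (- ?s) ^ n'"
      using branch_slope[OF l L] branch_slope[OF r R]
      by (simp_all add: deriv_left_def deriv_right_def)
    then have "(- ?s) ^ n = (- ?s) ^ n'" using m by (simp add: matching_def)
    then have "\<bar>- ?s\<bar> ^ n = \<bar>- ?s\<bar> ^ n'" by (metis power_abs)
    then have "n = n'" using s by (simp add: power_inject_exp)
    moreover have "u = u'" using m o by (simp add: matching_def)
    ultimately show False using Lc Rc by (auto split: if_splits)
  qed
  then show ?thesis by (auto simp: bifurcation_set_def matching_set_def)
qed

section \<open>Hausdorff measure of subsets of the line\<close>

lemma hausdorff_measure_mono: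
  assumes "A \<subseteq> B"
  shows "hausdorff_measure d A \<le> hausdorff_measure d B"
  unfolding hausdorff_measure_def hausdorff_premeasure_def
  by (intro SUP_mono' Inf_superset_mono) (use assms in blast)

lemma hausdorff_measure_zero_if_interval_covers:
  fixes A :: "real set" and c r :: "nat \<Rightarrow> real"
  assumes d: "0 < d" and r0: "\<And>n. 0 \<le> r n" and r: "r \<longlonglongrightarrow> 0"
    and lim: "(\<lambda>n. c n * r n powr d) \<longlonglongrightarrow> 0"
    and cover: "\<And>n. \<exists>P. finite P \<and> real (card P) \<le> c n \<and> A \<subseteq> (\<Union>p\<in>P. {p .. p + r n})"
  shows "hausdorff_measure d A = 0"
proof -
  have approx: "hausdorff_premeasure d \<epsilon> A \<le> 0 + ennreal e" if \<epsilon>: "0 < \<epsilon>" and e: "0 < e" for \<epsilon> e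
  proof -
    have "\<forall>\<^sub>F n in sequentially. r n < \<epsilon> \<and> c n * r n powr d < e"
      using order_tendstoD(2)[OF r \<epsilon>] order_tendstoD(2)[OF lim e] by eventually_elim simp
    then obtain n where n: "r n < \<epsilon>" "c n * r n powr d < e"
      by (auto simp: eventually_sequentially)
    obtain P where P: "finite P" "real (card P) \<le> c n" "A \<subseteq> (\<Union>p\<in>P. {p .. p + r n})"
      using cover by blast
    obtain h where h: "bij_betw h {0..<card P} P"
      using ex_bij_betw_nat_finite[OF P(1)] by blast
    define U where "U i = (if i < card P then {h i .. h i + r n} else {})" for i
    have dU: "diameter (U i) = (if i < card P then r n else 0)" for i
      using r0[of n] by (simp add: U_def)
    have pU: "diam_pow d (U i) = (if i < card P then r n powr d else 0)" for i
      using dU[of i] d r0[of n] by (auto simp: diam_pow_def U_def)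
    have "A \<subseteq> (\<Union>i. U i)"
    proof
      fix x assume "x \<in> A"
      then obtain p where p: "p \<in> P" "x \<in> {p .. p + r n}" using P by blast
      then have "p \<in> h ` {0..<card P}" using h by (simp add: bij_betw_def)
      then obtain i where "i < card P" "h i = p" by auto
      then show "x \<in> (\<Union>i. U i)" using p by (auto simp: U_def)
    qed
    moreover have "bounded (U i) \<and> diameter (U i) \<le> \<epsilon>" for i
      using dU[of i] n \<epsilon> by (auto simp: U_def)
    ultimately have "hausdorff_premeasure d \<epsilon> A \<le> (\<Sum>i. ennreal (diam_pow d (U i)))"
      unfolding hausdorff_premeasure_def by (intro Inf_lower) blast
    also have "\<dots> = (\<Sum>i<card P. ennreal (diam_pow d (U i)))"
      by (rule suminf_finite) (auto simp: pU)
    also have "\<dots> = (\<Sum>i<card P. ennreal (r n powr d))"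
      by (intro sum.cong) (auto simp: pU)
    also have "\<dots> = ennreal (real (card P) * r n powr d)"
      by (simp add: ennreal_mult ennreal_of_nat_eq_real_of_nat)
    also have "\<dots> \<le> ennreal e"
      using mult_right_mono[OF P(2), of "r n powr d"] n by (intro ennreal_leI) simp
    finally show ?thesis by simp
  qed
  have "hausdorff_premeasure d \<epsilon> A \<le> 0" if "0 < \<epsilon>" for \<epsilon>
    by (rule ennreal_le_epsilon) (rule approx[OF that])
  then have "hausdorff_measure d A \<le> 0"
    unfolding hausdorff_measure_def by (intro SUP_least) auto
  then show ?thesis by simp
qed

lemma negligible_if_interval_covers:
  fixes A :: "real set" and c r :: "nat \<Rightarrow> real"
  assumes r0: "\<And>n. 0 \<le> r n" and lim: "(\<lambda>n. c n * r n) \<longlonglongrightarrow> 0"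
    and cover: "\<And>n. \<exists>P. finite P \<and> real (card P) \<le> c n \<and> A \<subseteq> (\<Union>p\<in>P. {p .. p + r n})"
  shows "negligible A"
  unfolding negligible_outer
proof (intro allI impI)
  fix e :: real assume "0 < e"
  then have "\<forall>\<^sub>F n in sequentially. c n * r n < e" using order_tendstoD(2)[OF lim] by blast
  then obtain n where n: "c n * r n < e" by (auto simp: eventually_sequentially)
  obtain P where P: "finite P" "real (card P) \<le> c n" "A \<subseteq> (\<Union>p\<in>P. {p .. p + r n})"
    using cover by blast
  have "measure lebesgue (\<Union>p\<in>P. {p .. p + r n}) \<le> (\<Sum>p\<in>P. measure lebesgue {p .. p + r n})"
    by (rule measure_UNION_le[OF P(1)]) auto
  also have "\<dots> = real (card P) * r n" using r0[of n] by simp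
  also have "\<dots> < e" using mult_right_mono[OF P(2) r0[of n]] n by linarith
  finally show "\<exists>T. A \<subseteq> T \<and> T \<in> lmeasurable \<and> measure lebesgue T < e"
    using P by (intro exI[of _ "\<Union>p\<in>P. {p .. p + r n}"]) (auto intro!: fmeasurable.finite_UN)
qed

text \<open>
  The inverse of \<open>g\<close> is Hoelder continuous with exponent \<open>d\<close>, so it turns a cover of the image into a
  cover of \<open>[0, 1)\<close> by intervals whose total length is at most \<open>2 * C\<close> times the \<open>d\<close>-dimensional
  sum of the given cover.  Countable subadditivity of Lebesgue measure keeps this sum away from \<open>0\<close>.
\<close>
lemma hausdorff_measure_nonzero_if_expanding:
  fixes g :: "real \<Rightarrow> real"
  assumes d: "0 \<le> d" and C: "1 \<le> C"
    and g: "\<And>y y'. \<lbrakk>y \<in> {0..<1}; y' \<in> {0..<1}\<rbrakk> \<Longrightarrow> \<bar>y - y'\<bar> \<le> C * \<bar>g y - g y'\<bar> powr d"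
  shows "hausdorff_measure d (g ` {0..<1}) \<noteq> 0"
proof
  let ?A = "g ` {0..<1}"
  assume "hausdorff_measure d ?A = 0"
  then have "hausdorff_premeasure d 1 ?A \<le> 0"
    unfolding hausdorff_measure_def by (metis SUP_upper greaterThan_iff zero_less_one)
  then have "hausdorff_premeasure d 1 ?A < ennreal (1 / (4 * C))" using C
    by (simp add: order.strict_trans1)
  then obtain U :: "nat \<Rightarrow> real set" where cov: "?A \<subseteq> (\<Union>n. U n)" and bd: "\<And>n. bounded (U n)"
    and small: "(\<Sum>n. ennreal (diam_pow d (U n))) < ennreal (1 / (4 * C))"
    unfolding hausdorff_premeasure_def by (auto simp: Inf_less_iff)
  define V where "V n = {y \<in> {0..<1}. g y \<in> U n}" for n
  define a where "a n = (SOME y. y \<in> V n)" for n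
  define \<rho> where "\<rho> n = C * diam_pow d (U n)" for n
  have \<rho>0: "0 \<le> \<rho> n" for n using C by (simp add: \<rho>_def diam_pow_def)
  have V: "V n \<subseteq> {a n - \<rho> n .. a n + \<rho> n}" for n
  proof
    fix y assume y: "y \<in> V n"
    then have a: "a n \<in> V n" unfolding a_def by (rule someI)
    have "\<bar>g y - g (a n)\<bar> powr d \<le> diam_pow d (U n)"
    proof -
      have "\<bar>g y - g (a n)\<bar> \<le> diameter (U n)"
        using diameter_bounded_bound[OF bd, of "g y" n "g (a n)"] y a
        by (simp add: V_def dist_real_def)
      then have "\<bar>g y - g (a n)\<bar> powr d \<le> diameter (U n) powr d"
        using d by (intro powr_mono2) auto
      then show ?thesis using y by (auto simp: diam_pow_def V_def)
    qed
    then have "C * \<bar>g y - g (a n)\<bar> powr d \<le> \<rho> n" unfolding \<rho>_def using C by simp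
    then have "\<bar>y - a n\<bar> \<le> \<rho> n" using g[of y "a n"] y a by (force simp: V_def)
    then show "y \<in> {a n - \<rho> n .. a n + \<rho> n}" by auto
  qed
  have "{0..<1} \<subseteq> (\<Union>n. {a n - \<rho> n .. a n + \<rho> n})"
  proof
    fix y :: real assume y: "y \<in> {0..<1}"
    then obtain n where "g y \<in> U n" using cov by blast
    then have "y \<in> V n" using y by (simp add: V_def)
    then show "y \<in> (\<Union>n. {a n - \<rho> n .. a n + \<rho> n})" using V by blast
  qed
  then have "emeasure lborel {0..<1::real} \<le> emeasure lborel (\<Union>n. {a n - \<rho> n .. a n + \<rho> n})"
    by (intro emeasure_mono) auto
  also have "\<dots> \<le> (\<Sum>n. emeasure lborel {a n - \<rho> n .. a n + \<rho> n})"
    by (intro emeasure_subadditive_countably) auto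
  also have "\<dots> = (\<Sum>n. ennreal (2 * C) * ennreal (diam_pow d (U n)))"
    using C \<rho>0 by (intro suminf_cong) (simp add: \<rho>_def diam_pow_def flip: ennreal_mult)
  also have "\<dots> = ennreal (2 * C) * (\<Sum>n. ennreal (diam_pow d (U n)))" by simp
  also have "\<dots> \<le> ennreal (2 * C) * ennreal (1 / (4 * C))"
    using small by (intro mult_left_mono) auto
  also have "\<dots> = ennreal (1 / 2)" using C by (simp flip: ennreal_mult)
  finally have "ennreal 1 \<le> ennreal (1 / 2)" by simp
  then show False by (subst (asm) ennreal_le_iff) auto
qed

section \<open>Orbits that keep away from zero\<close>

lemma frac_mult_frac: "frac (of_nat k * frac x) = frac (of_nat k * (x :: real))"
proof (rule frac_eqI_Ints)
  have "of_nat k * frac x - of_nat k * x = - (of_nat k * of_int \<lfloor>x\<rfloor>)"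
    by (simp add: frac_def algebra_simps)
  then show "of_nat k * frac x - of_nat k * x \<in> \<int>" by simp
qed

definition avoiding :: "nat \<Rightarrow> real set" where
  "avoiding b = {x \<in> {0..<1}. \<forall>k. 1 / real b \<le> frac (real b ^ k * x)}"

text \<open>\<^term>\<open>avoiding b\<close> consists of the numbers whose base \<open>b\<close> expansion omits the digit \<open>0\<close>: it is
  contained in the union of its \<open>b - 1\<close> images under the maps \<open>x \<mapsto> (j + x) / b\<close> with \<open>0 < j < b\<close>.\<close>
lemma avoiding_cover:
  assumes b: "b \<ge> 2"
  shows "\<exists>P. finite P \<and> card P \<le> (b - 1) ^ n \<and> avoiding b \<subseteq> (\<Union>p\<in>P. {p .. p + (1 / real b) ^ n})"
proof (induction n)
  case 0
  show ?case by (intro exI[of _ "{0}"]) (auto simp: avoiding_def)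
next
  case (Suc n)
  then obtain P where P: "finite P" "card P \<le> (b - 1) ^ n"
    "avoiding b \<subseteq> (\<Union>p\<in>P. {p .. p + (1 / real b) ^ n})" by blast
  define P' where "P' = (\<lambda>(j, p). (real j + p) / real b) ` ({1..<b} \<times> P)"
  have "card P' \<le> card ({1..<b} \<times> P)" unfolding P'_def using P(1) by (intro card_image_le) auto
  also have "\<dots> \<le> (b - 1) ^ Suc n" using P(2) by (simp add: card_cartesian_product)
  finally have "card P' \<le> (b - 1) ^ Suc n" .
  moreover have "finite P'" unfolding P'_def using P(1) by simp
  moreover have "avoiding b \<subseteq> (\<Union>p\<in>P'. {p .. p + (1 / real b) ^ Suc n})"
  proof
    fix x assume x: "x \<in> avoiding b"
    then have x01: "0 \<le> x" "x < 1" and xk: "\<And>k. 1 / real b \<le> frac (real b ^ k * x)"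
      by (auto simp: avoiding_def)
    define j where "j = nat \<lfloor>real b * x\<rfloor>"
    have "real b * x \<ge> 1" using xk[of 0] x01 b by (simp add: frac_eq field_simps)
    moreover have "real b * x < real b" using x01 b by simp
    ultimately have j: "j \<in> {1..<b}" unfolding j_def by (auto simp: le_floor_iff floor_less_iff nat_less_iff le_nat_iff)
    have jx: "real b * x = real j + frac (real b * x)" unfolding j_def frac_def using x01 by simp
    have "frac (real b * x) \<in> avoiding b"
      unfolding avoiding_def
    proof (intro CollectI conjI allI)
      show "frac (real b * x) \<in> {0..<1}" by (simp add: frac_lt_1)
      fix k
      have "frac (real b ^ k * frac (real b * x)) = frac (real b ^ Suc k * x)"
        using frac_mult_frac[of "b ^ k" "real b * x"] by (simp add: mult_ac)
      then show "1 / real b \<le> frac (real b ^ k * frac (real b * x))" using xk by metis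
    qed
    then obtain p where p: "p \<in> P" "p \<le> frac (real b * x)" "frac (real b * x) \<le> p + (1 / real b) ^ n"
      using P(3) by auto
    have "(real j + p) / real b \<in> P'" unfolding P'_def using j p by auto
    moreover have "(real j + p) / real b \<le> x" "x \<le> (real j + p) / real b + (1 / real b) ^ Suc n"
    proof -
      have x: "x = (real j + frac (real b * x)) / real b"
        using jx b by (simp add: nonzero_eq_divide_eq mult.commute)
      have "(real j + p) / real b \<le> (real j + frac (real b * x)) / real b"
        using p by (intro divide_right_mono) auto
      also have "\<dots> = x" by (rule x[symmetric])
      finally show "(real j + p) / real b \<le> x" .
      have "x = (real j + frac (real b * x)) / real b" by (rule x)
      also have "\<dots> \<le> (real j + (p + (1 / real b) ^ n)) / real b"
        using p by (intro divide_right_mono) auto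
      also have "\<dots> = (real j + p) / real b + (1 / real b) ^ Suc n"
        by (simp add: add_divide_distrib)
      finally show "x \<le> (real j + p) / real b + (1 / real b) ^ Suc n" .
    qed
    ultimately show "x \<in> (\<Union>p\<in>P'. {p .. p + (1 / real b) ^ Suc n})" by auto
  qed
  ultimately show ?case by blast
qed

lemma avoiding_cover_real:
  assumes b: "b \<ge> 2"
  shows "\<exists>P. finite P \<and> real (card P) \<le> (real b - 1) ^ n \<and>
    avoiding b \<subseteq> (\<Union>p\<in>P. {p .. p + (1 / real b) ^ n})"
proof -
  obtain P where P: "finite P" "card P \<le> (b - 1) ^ n"
    "avoiding b \<subseteq> (\<Union>p\<in>P. {p .. p + (1 / real b) ^ n})" using avoiding_cover[OF b] by blast
  from P(2) have "real (card P) \<le> real ((b - 1) ^ n)" by (simp only: of_nat_le_iff)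
  then show ?thesis using P b by (auto simp: of_nat_diff)
qed

lemma negligible_avoiding:
  assumes b: "b \<ge> 2"
  shows "negligible (avoiding b)"
proof (rule negligible_if_interval_covers[OF _ _ avoiding_cover_real[OF b]])
  have "(\<lambda>n. ((real b - 1) / real b) ^ n) \<longlonglongrightarrow> 0"
    using b by (intro LIMSEQ_realpow_zero) auto
  then show "(\<lambda>n. (real b - 1) ^ n * (1 / real b) ^ n) \<longlonglongrightarrow> 0"
    by (simp add: power_divide)
qed auto

lemma hausdorff_measure_avoiding:
  assumes b: "b \<ge> 2"
  shows "\<exists>d. 0 < d \<and> d < 1 \<and> hausdorff_measure d (avoiding b) = 0"
proof -
  \<comment> \<open>Any \<open>d\<close> with \<open>b - 1 < b powr d < b\<close> works; here \<open>b powr d\<close> is the midpoint.\<close>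
  define d where "d = log (real b) (real b - 1 / 2)"
  have d: "0 < d" "d < 1" using b by (auto simp: d_def)
  have bd: "real b powr d = real b - 1 / 2" unfolding d_def using b by simp
  have "(\<lambda>n. ((real b - 1) / (real b - 1 / 2)) ^ n) \<longlonglongrightarrow> 0"
    using b by (intro LIMSEQ_realpow_zero) auto
  moreover have "(real b - 1) ^ n * ((1 / real b) ^ n) powr d = ((real b - 1) / (real b - 1 / 2)) ^ n" for n
  proof -
    have "((1 / real b) ^ n) powr d = ((1 / real b) powr d) ^ n"
      using b by (simp add: powr_powr powr_realpow[symmetric] mult.commute)
    also have "(1 / real b) powr d = 1 / (real b - 1 / 2)"
      using b bd by (simp add: powr_divide)
    finally show ?thesis by (simp add: power_divide)
  qed
  ultimately have "hausdorff_measure d (avoiding b) = 0"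
    using b d avoiding_cover_real[OF b]
    by (intro hausdorff_measure_zero_if_interval_covers[where r = "\<lambda>n. (1 / real b) ^ n"
          and c = "\<lambda>n. (real b - 1) ^ n"])
      (auto intro!: LIMSEQ_realpow_zero)
  then show ?thesis using d by blast
qed

lemma hausdorff_measure_unit_interval:
  assumes d: "1 < d"
  shows "hausdorff_measure d {0..1::real} = 0"
proof (rule hausdorff_measure_zero_if_interval_covers[where r = "\<lambda>n. 1 / (real n + 1)"
      and c = "\<lambda>n. real n + 1"])
  have top: "filterlim (\<lambda>n. real n + 1) at_top sequentially"
    using filterlim_sequentially_Suc[of real at_top] filterlim_real_sequentially by (simp add: add.commute)
  show "(\<lambda>n. 1 / (real n + 1)) \<longlonglongrightarrow> 0"
    using tendsto_inverse_0_at_top[OF top] by (simp add: inverse_eq_divide)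
  have "(real n + 1) * (1 / (real n + 1)) powr d = (real n + 1) powr (1 - d)" for n
    by (simp add: powr_divide powr_diff)
  then show "(\<lambda>n. (real n + 1) * (1 / (real n + 1)) powr d) \<longlonglongrightarrow> 0"
    using tendsto_neg_powr[OF _ top, of "1 - d"] d by simp
  fix n
  let ?P = "(\<lambda>i. real i / (real n + 1)) ` {..n}"
  have "card ?P \<le> n + 1" using card_image_le[of "{..n}"] by simp
  then have "real (card ?P) \<le> real n + 1" by linarith
  moreover have "{0..1} \<subseteq> (\<Union>p\<in>?P. {p .. p + 1 / (real n + 1)})"
  proof
    fix x :: real assume x: "x \<in> {0..1}"
    define i where "i = min n (nat \<lfloor>(real n + 1) * x\<rfloor>)"
    have "(real n + 1) * x \<le> real n + 1" using x by (simp add: mult_left_le)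
    moreover have "0 \<le> (real n + 1) * x" using x by simp
    ultimately have "real i \<le> (real n + 1) * x \<and> (real n + 1) * x \<le> real i + 1"
      unfolding i_def by (cases "nat \<lfloor>(real n + 1) * x\<rfloor> \<le> n") linarith+
    then have "real i / (real n + 1) \<le> x" "x \<le> real i / (real n + 1) + 1 / (real n + 1)"
      by (auto simp: field_simps)
    moreover have "i \<le> n" by (simp add: i_def)
    ultimately show "x \<in> (\<Union>p\<in>?P. {p .. p + 1 / (real n + 1)})" by auto
  qed
  ultimately show "\<exists>P. finite P \<and> real (card P) \<le> real n + 1 \<and>
      {0..1} \<subseteq> (\<Union>p\<in>P. {p .. p + 1 / (real n + 1)})" by blast
qed (use d in auto)

section \<open>A Cantor set of large dimension\<close>

text \<open>
  The base \<open>m\<close> digits \<open>e\<close> of \<open>y\<close> are shifted to \<open>e + 1\<close> and read in base \<open>B = m + 2\<close>.  Thus neither the digit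
  \<open>0\<close> nor the digit \<open>B - 1\<close> occurs, which keeps the point and all its shifts away from both \<open>0\<close> and \<open>1\<close>.
\<close>
definition cantor_point :: "nat \<Rightarrow> real \<Rightarrow> real" where
  "cantor_point m y = (\<Sum>i. (real_of_int \<lfloor>real m * frac (real m ^ i * y)\<rfloor> + 1) / (real m + 2) ^ Suc i)"

lemma cantor_digit_bounds:
  assumes "m \<ge> 1"
  shows "0 \<le> \<lfloor>real m * frac x\<rfloor>" "\<lfloor>real m * frac x\<rfloor> + 1 \<le> int m"
proof -
  have "real m * frac x < real m" using frac_lt_1[of x] assms by simp
  then have "\<lfloor>real m * frac x\<rfloor> < int m" by (simp add: floor_less_iff)
  then show "\<lfloor>real m * frac x\<rfloor> + 1 \<le> int m" by simp
qed simp

lemma cantor_point_summable_bounds: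
  assumes m: "m \<ge> 1"
  shows "summable (\<lambda>i. (real_of_int \<lfloor>real m * frac (real m ^ i * y)\<rfloor> + 1) / (real m + 2) ^ Suc i)"
    and "0 \<le> cantor_point m y" and "cantor_point m y \<le> 1"
proof -
  let ?f = "\<lambda>i. (real_of_int \<lfloor>real m * frac (real m ^ i * y)\<rfloor> + 1) / (real m + 2) ^ Suc i"
  let ?h = "\<lambda>i. real m / (real m + 2) * (1 / (real m + 2)) ^ i"
  have "?h sums (real m / (real m + 2) * (1 / (1 - 1 / (real m + 2))))"
    by (intro sums_mult geometric_sums) auto
  also have "real m / (real m + 2) * (1 / (1 - 1 / (real m + 2))) = real m / (real m + 1)"
  proof -
    have e: "1 - 1 / (real m + 2) = (real m + 1) / (real m + 2)" by (simp add: field_simps)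
    have "real m + 2 \<noteq> 0" by linarith
    then show ?thesis unfolding e divide_divide_eq_right times_divide_times_eq
      by (simp only: mult_1_left mult_1_right mult_divide_mult_cancel_left
          mult.commute[of "real m + 2"] nonzero_mult_divide_mult_cancel_right simp_thms)
  qed
  finally have h: "?h sums (real m / (real m + 1))" .
  have f0: "0 \<le> ?f i" for i
    using cantor_digit_bounds(1)[OF m, of "real m ^ i * y"] by simp
  have fh: "?f i \<le> ?h i" for i
  proof -
    have "real_of_int (\<lfloor>real m * frac (real m ^ i * y)\<rfloor> + 1) \<le> real_of_int (int m)"
      using cantor_digit_bounds(2)[OF m, of "real m ^ i * y"] by (simp only: of_int_le_iff)
    then have "?f i \<le> real m / (real m + 2) ^ Suc i" by (intro divide_right_mono) auto
    then show ?thesis by (simp add: power_divide)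
  qed
  show s: "summable ?f"
    by (rule summable_comparison_test'[of ?h 0]) (use h f0 fh in \<open>auto simp: sums_iff\<close>)
  show "0 \<le> cantor_point m y" unfolding cantor_point_def using s f0 by (rule suminf_nonneg)
  have "cantor_point m y \<le> real m / (real m + 1)"
    unfolding cantor_point_def using suminf_le[OF fh s] h by (simp add: sums_iff)
  also have "\<dots> \<le> 1" by simp
  finally show "cantor_point m y \<le> 1" .
qed

lemma cantor_point_shift:
  assumes m: "m \<ge> 1" and y: "y \<in> {0..<1}"
  shows "(real m + 2) * cantor_point m y
    = real_of_int \<lfloor>real m * y\<rfloor> + 1 + cantor_point m (frac (real m * y))"
proof -
  let ?B = "real m + 2"
  let ?f = "\<lambda>y i. (real_of_int \<lfloor>real m * frac (real m ^ i * y)\<rfloor> + 1) / ?B ^ Suc i"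
  have "?f (frac (real m * y)) i = ?B * ?f y (Suc i)" for i
    using frac_mult_frac[of "m ^ i" "real m * y"] by (simp add: mult_ac)
  then have "cantor_point m (frac (real m * y)) = (\<Sum>i. ?B * ?f y (Suc i))"
    unfolding cantor_point_def by presburger
  also have "\<dots> = ?B * (\<Sum>i. ?f y (Suc i))"
    using cantor_point_summable_bounds(1)[OF m, of y] by (intro suminf_mult) (subst summable_Suc_iff)
  also have "(\<Sum>i. ?f y (Suc i)) = cantor_point m y - ?f y 0"
    unfolding cantor_point_def using suminf_split_head[OF cantor_point_summable_bounds(1)[OF m, of y]]
    by simp
  also have "?B * (cantor_point m y - ?f y 0)
      = ?B * cantor_point m y - (real_of_int \<lfloor>real m * y\<rfloor> + 1)"
  proof -
    have "?B \<noteq> 0" by linarith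
    then have "?B * ?f y 0 = real_of_int \<lfloor>real m * y\<rfloor> + 1" using y by simp
    then show ?thesis by (simp only: right_diff_distrib)
  qed
  finally show ?thesis by simp
qed

lemma cantor_point_range:
  assumes m: "m \<ge> 1" and y: "y \<in> {0..<1}"
  shows "1 / (real m + 2) \<le> cantor_point m y" "cantor_point m y \<le> 1 - 1 / (real m + 2)"
proof -
  have d: "0 \<le> \<lfloor>real m * y\<rfloor>" "\<lfloor>real m * y\<rfloor> + 1 \<le> int m"
    using cantor_digit_bounds[OF m, of y] y by simp_all
  have "0 \<le> real_of_int \<lfloor>real m * y\<rfloor>" "real_of_int \<lfloor>real m * y\<rfloor> + 1 \<le> real m"
    using d by linarith+
  then have "1 \<le> (real m + 2) * cantor_point m y" "(real m + 2) * cantor_point m y \<le> real m + 1"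
    unfolding cantor_point_shift[OF m y]
    using cantor_point_summable_bounds(2,3)[OF m, of "frac (real m * y)"] by linarith+
  then show "1 / (real m + 2) \<le> cantor_point m y" "cantor_point m y \<le> 1 - 1 / (real m + 2)"
    by (auto simp: field_simps)
qed

lemma cantor_point_orbit:
  assumes m: "m \<ge> 1" and y: "y \<in> {0..<1}"
  shows "\<exists>y'\<in>{0..<1}. frac ((real m + 2) ^ q * cantor_point m y) = cantor_point m y'"
proof (induction q)
  case 0
  have "frac (cantor_point m y) = cantor_point m y"
  proof -
    have "0 < 1 / (real m + 2)" by simp
    then have "0 \<le> cantor_point m y \<and> cantor_point m y < 1"
      using cantor_point_range[OF m y] by linarith
    then show ?thesis by (simp add: frac_eq)
  qed
  then show ?case using y by auto
next
  case (Suc q)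
  then obtain y' where y': "y' \<in> {0..<1}"
    "frac ((real m + 2) ^ q * cantor_point m y) = cantor_point m y'" by blast
  define y'' where "y'' = frac (real m * y')"
  have y'': "y'' \<in> {0..<1}" by (simp add: y''_def frac_lt_1)
  have "frac ((real m + 2) ^ Suc q * cantor_point m y) = frac ((real m + 2) * cantor_point m y')"
    using frac_mult_frac[of "m + 2" "(real m + 2) ^ q * cantor_point m y"] y'(2)
    by (simp add: mult_ac add.commute)
  also have "\<dots> = cantor_point m y''"
    unfolding cantor_point_shift[OF m y'(1)] y''_def[symmetric]
  proof -
    have "0 < 1 / (real m + 2)" by simp
    then have "0 \<le> cantor_point m y'' \<and> cantor_point m y'' < 1"
      using cantor_point_range[OF m y''] by linarith
    then show "frac (real_of_int \<lfloor>real m * y'\<rfloor> + 1 + cantor_point m y'') = cantor_point m y''"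
      by (subst frac_unique_iff) auto
  qed
  finally show ?case using y'' by blast
qed

text \<open>Points that agree in their first digit are pulled apart by the factor \<open>m\<close> on one side and \<open>m + 2\<close>
  on the other side.  At the first differing digit the images are separated because the tails
  stay within \<open>[1 / B, 1 - 1 / B]\<close>.\<close>
lemma cantor_point_separation:
  assumes m: "m \<ge> 1"
  shows "\<lbrakk>y \<in> {0..<1}; y' \<in> {0..<1}; 1 / real m ^ n \<le> \<bar>y - y'\<bar>\<rbrakk>
    \<Longrightarrow> 1 / (real m + 2) ^ Suc n \<le> \<bar>cantor_point m y - cantor_point m y'\<bar>"
proof (induction n arbitrary: y y')
  case 0
  then show ?case by auto
next
  case (Suc n)
  let ?g = "cantor_point m"
  let ?B = "real m + 2"
  have B: "?B * ?g y = real_of_int \<lfloor>real m * y\<rfloor> + 1 + ?g (frac (real m * y))"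
    "?B * ?g y' = real_of_int \<lfloor>real m * y'\<rfloor> + 1 + ?g (frac (real m * y'))"
    using cantor_point_shift[OF m] Suc.prems by blast+
  have fr: "frac (real m * y) \<in> {0..<1}" "frac (real m * y') \<in> {0..<1}" by (simp_all add: frac_lt_1)
  have "1 / ?B ^ Suc n \<le> \<bar>?B * ?g y - ?B * ?g y'\<bar>"
  proof (cases "\<lfloor>real m * y\<rfloor> = \<lfloor>real m * y'\<rfloor>")
    case True
    then have "frac (real m * y) - frac (real m * y') = real m * (y - y')"
      by (simp add: frac_def algebra_simps)
    then have "\<bar>frac (real m * y) - frac (real m * y')\<bar> = real m * \<bar>y - y'\<bar>" by (simp add: abs_mult)
    moreover have "1 / real m ^ n \<le> real m * \<bar>y - y'\<bar>"
      using Suc.prems(3) m by (simp add: field_simps)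
    ultimately have "1 / ?B ^ Suc n \<le> \<bar>?g (frac (real m * y)) - ?g (frac (real m * y'))\<bar>"
      using Suc.IH[OF fr] by simp
    then show ?thesis using B True by simp
  next
    case False
    define z where "z = real_of_int (\<lfloor>real m * y\<rfloor> - \<lfloor>real m * y'\<rfloor>)"
    have z: "1 \<le> \<bar>z\<bar>" using False unfolding z_def by linarith
    have "\<bar>?g (frac (real m * y)) - ?g (frac (real m * y'))\<bar> \<le> 1 - 2 / ?B"
      using cantor_point_range[OF m fr(1)] cantor_point_range[OF m fr(2)]
      by (simp add: abs_le_iff field_simps)
    moreover have "?B * ?g y - ?B * ?g y' = z + (?g (frac (real m * y)) - ?g (frac (real m * y')))"
      using B by (simp add: z_def)
    ultimately have "2 / ?B \<le> \<bar>?B * ?g y - ?B * ?g y'\<bar>" using z by linarith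
    moreover have "1 / ?B ^ Suc n \<le> 1 / ?B"
    proof -
      have "1 / ?B ^ Suc n \<le> 1 / ?B ^ 1"
        by (intro divide_left_mono power_increasing) auto
      then show ?thesis by (simp only: power_one_right)
    qed
    moreover have "1 / ?B \<le> 2 / ?B" by (simp add: field_simps)
    ultimately show ?thesis by linarith
  qed
  also have "\<bar>?B * ?g y - ?B * ?g y'\<bar> = ?B * \<bar>?g y - ?g y'\<bar>"
    by (simp add: abs_mult flip: right_diff_distrib)
  finally have "1 / ?B ^ Suc n / ?B \<le> \<bar>?g y - ?g y'\<bar>"
    by (simp only: pos_divide_le_eq[of ?B] mult.commute)
  then show ?case by (simp add: mult.commute)
qed

lemma cantor_point_expanding:
  assumes m: "m \<ge> 2" and d: "0 \<le> d" and dm: "(real m + 2) powr d \<le> real m"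
    and y: "y \<in> {0..<1}" "y' \<in> {0..<1}"
  shows "\<bar>y - y'\<bar> \<le> real m ^ 2 * \<bar>cantor_point m y - cantor_point m y'\<bar> powr d"
proof (cases "y = y'")
  case False
  have "\<exists>n. 1 / real m ^ n \<le> \<bar>y - y'\<bar>"
    using real_arch_pow_inv[of "\<bar>y - y'\<bar>" "1 / real m"] False m
    by (auto simp: power_divide intro: less_imp_le)
  define n where "n = (LEAST n. 1 / real m ^ n \<le> \<bar>y - y'\<bar>)"
  have n: "1 / real m ^ n \<le> \<bar>y - y'\<bar>"
    unfolding n_def using \<open>\<exists>n. _\<close> by (rule LeastI_ex)
  have "n \<noteq> 0" using n y by (cases n) auto
  then obtain k where k: "n = Suc k" by (cases n) auto
  have "\<not> 1 / real m ^ k \<le> \<bar>y - y'\<bar>" using not_less_Least[of k "\<lambda>n. 1 / real m ^ n \<le> \<bar>y - y'\<bar>"] k unfolding n_def by simp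
  then have "\<bar>y - y'\<bar> \<le> real m ^ 2 * (1 / real m ^ Suc n)"
    using k m by (simp add: power2_eq_square)
  also have "1 / real m ^ Suc n \<le> 1 / ((real m + 2) powr d) ^ Suc n"
    using m dm by (intro divide_left_mono power_mono mult_pos_pos) auto
  also have "1 / ((real m + 2) powr d) ^ Suc n = (1 / (real m + 2) ^ Suc n) powr d"
  proof -
    have "((real m + 2) ^ i) powr d = ((real m + 2) powr d) ^ i" for i
      by (simp add: powr_powr powr_power mult.commute flip: powr_realpow)
    then show ?thesis by (simp only: powr_divide powr_one_eq_one)
  qed
  also have "\<dots> \<le> \<bar>cantor_point m y - cantor_point m y'\<bar> powr d"
    using cantor_point_separation[OF _ y n] m d by (intro powr_mono2) auto
  finally show ?thesis by (simp add: mult_left_mono)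
qed simp

section \<open>A scaled copy of the Cantor set inside the bifurcation set\<close>

text \<open>Every power \<open>s ^ k\<close> is at most \<open>N\<close> factors \<open>s\<close> short of a power of \<open>s ^ N\<close>.  A point within
  \<open>1 / s ^ (2 * N)\<close> of an integer would still be within \<open>1 / s ^ N\<close> of an integer at that later time.\<close>
lemma frac_power_bounds:
  fixes s :: nat
  assumes s: "s \<ge> 2" and N: "N \<ge> 1"
    and x: "\<And>q. 1 / real s ^ N \<le> frac ((real s ^ N) ^ q * x)"
      "\<And>q. frac ((real s ^ N) ^ q * x) \<le> 1 - 1 / real s ^ N"
  shows "1 / real s ^ (2 * N) \<le> frac (real s ^ k * x)" "frac (real s ^ k * x) \<le> 1 - 1 / real s ^ (2 * N)"
proof -
  define q where "q = Suc (k div N)"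
  define r where "r = N * q - k"
  have "N * (k div N) + k mod N = k" "k mod N < N" "N * q = N + N * (k div N)"
    using N by (simp_all add: q_def)
  then have r: "r + k = N * q" "r \<le> N" unfolding r_def by linarith+
  define y where "y = frac (real s ^ k * x)"
  have y01: "0 \<le> y" "y < 1" by (simp_all add: y_def frac_lt_1)
  have fr: "frac (real s ^ r * y) = frac ((real s ^ N) ^ q * x)"
    using frac_mult_frac[of "s ^ r" "real s ^ k * x"] r
    by (simp add: y_def flip: power_add power_mult mult.assoc)
  have S: "0 < real s ^ N" "1 < real s ^ N" using s N by (auto intro: one_less_power)
  have small: "real s ^ r * t < 1 / real s ^ N" if t: "0 \<le> t" "t < 1 / real s ^ (2 * N)" for t
  proof -
    have "real s ^ r * t \<le> real s ^ N * t"
      using t r s by (intro mult_right_mono power_increasing) auto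
    also have "\<dots> < real s ^ N * (1 / real s ^ (2 * N))"
      using t S by (intro mult_strict_left_mono) auto
    also have "\<dots> = 1 / real s ^ N" using s by (simp add: mult_2 power_add)
    finally show ?thesis .
  qed
  have S1: "1 / real s ^ N < 1" using S by simp
  show "1 / real s ^ (2 * N) \<le> frac (real s ^ k * x)"
  proof (rule ccontr)
    assume "\<not> ?thesis"
    then have lt: "real s ^ r * y < 1 / real s ^ N" using small[of y] y01 by (simp add: y_def)
    then have "frac (real s ^ r * y) = real s ^ r * y"
      using y01 S1 by (subst frac_eq) auto
    then show False using lt fr x(1)[of q] by simp
  qed
  show "frac (real s ^ k * x) \<le> 1 - 1 / real s ^ (2 * N)"
  proof (rule ccontr)
    assume "\<not> ?thesis"
    then have lt: "real s ^ r * (1 - y) < 1 / real s ^ N" using small[of "1 - y"] y01 by (simp add: y_def)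
    have "0 < real s ^ r * (1 - y)" using y01 s by simp
    moreover have "real s ^ r * y - (1 - real s ^ r * (1 - y)) = real (s ^ r) - 1"
      by (simp add: algebra_simps)
    then have "real s ^ r * y - (1 - real s ^ r * (1 - y)) \<in> \<int>" by (metis Ints_1 Ints_diff Ints_of_nat)
    ultimately have "frac (real s ^ r * y) = 1 - real s ^ r * (1 - y)"
      using lt S1 by (subst frac_unique_iff) auto
    then show False using lt fr x(2)[of q] by simp
  qed
qed

lemma frac_signed_power_bound:
  fixes s :: nat
  assumes s: "s \<ge> 2" and N: "N \<ge> 1"
    and x: "\<And>q. 1 / real s ^ N \<le> frac ((real s ^ N) ^ q * x)"
      "\<And>q. frac ((real s ^ N) ^ q * x) \<le> 1 - 1 / real s ^ N"
  shows "1 / real s ^ (2 * N) \<le> frac ((- real s) ^ k * x)"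
proof (cases "even k")
  case True
  then show ?thesis using frac_power_bounds(1)[OF s N x, of k] by simp
next
  case False
  have b: "1 / real s ^ (2 * N) \<le> frac (real s ^ k * x)" "frac (real s ^ k * x) \<le> 1 - 1 / real s ^ (2 * N)"
    using frac_power_bounds[OF s N x] by blast+
  have "0 < 1 / real s ^ (2 * N)" using s by simp
  with b have "0 < frac (real s ^ k * x)" by linarith
  then have "real s ^ k * x \<notin> \<int>" by simp
  then have "frac (- (real s ^ k * x)) = 1 - frac (real s ^ k * x)" by (simp add: frac_neg)
  then show ?thesis using b False by simp
qed

text \<open>
  For the first \<open>2 * N + 2\<close> steps the orbit of the scaled point is \<open>s ^ n * \<gamma>\<close> for even \<open>n\<close> and
  \<open>1 - s ^ n * \<gamma>\<close> for odd \<open>n\<close>, both larger than \<open>\<gamma>\<close>.  Since \<open>2 * N + 2\<close> is even, it then continues as the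
  orbit of \<open>x\<close>, whose distance from the integers exceeds \<open>\<gamma>\<close>.
\<close>
lemma scaled_point_in_bifurcation_set:
  fixes s :: nat
  assumes s: "s \<ge> 2" and N: "N \<ge> 1" and x01: "0 < x" "x < 1"
    and x: "\<And>q. 1 / real s ^ N \<le> frac ((real s ^ N) ^ q * x)"
      "\<And>q. frac ((real s ^ N) ^ q * x) \<le> 1 - 1 / real s ^ N"
  shows "x / real s ^ (2 * N + 2) \<in> bifurcation_set (real s)"
proof -
  let ?M = "2 * N + 2"
  define \<gamma> where "\<gamma> = x / real s ^ ?M"
  have P: "0 < real s ^ j" for j using s by simp
  have g0: "0 < \<gamma>" unfolding \<gamma>_def using x01 P by (intro divide_pos_pos)
  have gM: "\<gamma> < 1 / real s ^ ?M" using x01 P[of ?M] by (simp add: \<gamma>_def divide_strict_right_mono)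
  have below: "1 / real s ^ ?M \<le> 1 / real s ^ j" if "j \<le> ?M" for j
    using that s by (intro divide_left_mono power_increasing) auto
  have "1 / real s ^ 1 \<le> 1 / 2" using s by (simp add: field_simps)
  then have g2: "\<gamma> < 1 / 2" using gM below[of 1] by linarith
  have "\<gamma> < frac ((- real s) ^ n * \<gamma>)" if n: "n \<ge> 1" for n
  proof (cases "n \<ge> ?M")
    case True
    have "(- real s) ^ n = (- real s) ^ (n - ?M) * (- real s) ^ ?M"
      using True by (metis le_add_diff_inverse2 power_add)
    also have "(- real s) ^ ?M = real s ^ ?M" by simp
    finally have e: "(- real s) ^ n = (- real s) ^ (n - ?M) * real s ^ ?M" .
    have "real s ^ ?M \<noteq> 0" using s by simp
    then have "real s ^ ?M * \<gamma> = x"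
      unfolding \<gamma>_def times_divide_eq_right by (rule nonzero_mult_div_cancel_left)
    then have "(- real s) ^ n * \<gamma> = (- real s) ^ (n - ?M) * x"
      unfolding e by (simp only: mult.assoc)
    then show ?thesis
      using frac_signed_power_bound[OF s N x, of "n - ?M"] gM below[of "2 * N"] by simp
  next
    case False
    define t where "t = real s ^ n * \<gamma>"
    have "t = x / real s ^ (?M - n)"
    proof -
      have "n + (?M - n) = ?M" using False by simp
      then have e: "real s ^ ?M = real s ^ n * real s ^ (?M - n)" by (metis power_add)
      show ?thesis unfolding t_def \<gamma>_def e using s by simp
    qed
    also have "\<dots> < 1 / real s ^ (?M - n)" using x01 P by (intro divide_strict_right_mono)
    also have "\<dots> \<le> 1 / real s ^ 1" using False s by (intro divide_left_mono power_increasing) auto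
    also have "\<dots> \<le> 1 / 2" using s by (simp add: field_simps)
    finally have t: "t < 1 / 2" .
    have "1 < real s ^ n" using s n by (intro one_less_power) auto
    then have gt: "\<gamma> < t" using g0 by (simp add: t_def)
    show ?thesis
    proof (cases "even n")
      case True
      then have e: "(- real s) ^ n * \<gamma> = t" by (simp add: t_def)
      have "frac t = t" using t gt g0 by (simp add: frac_eq)
      then show ?thesis using e gt by simp
    next
      case False
      then have e: "(- real s) ^ n * \<gamma> = - t" by (simp add: t_def)
      have "frac (- t) = 1 - t" using t gt g0 by (subst frac_unique_iff) auto
      then show ?thesis using e t g2 by simp
    qed
  qed
  moreover have "\<gamma> < 1" using g2 by simp
  ultimately have "\<gamma> \<in> bifurcation_set (real s)"
    using orbit_greater_imp_bifurcation_set[OF s g0] by blast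
  then show ?thesis unfolding \<gamma>_def .
qed

text \<open>For \<open>d < 1\<close> there is an \<open>N\<close> with \<open>B powr d \<le> B - 2\<close> for \<open>B = s ^ N\<close>.  By the expansion estimate for
  \<^term>\<open>cantor_point (s ^ N - 2)\<close>, its image then has positive \<open>d\<close>-dimensional measure.\<close>
lemma hausdorff_measure_bifurcation_set_nonzero:
  fixes s :: nat
  assumes s: "s \<ge> 2" and d: "0 \<le> d" "d < 1"
  shows "hausdorff_measure d (bifurcation_set (real s)) \<noteq> 0"
proof -
  define N where "N = max 2 (nat \<lceil>1 / (1 - d)\<rceil>)"
  have N: "N \<ge> 2" by (simp add: N_def)
  \<comment> \<open>This choice gives \<open>B powr (1 - d) \<ge> s \<ge> 2\<close>, and \<open>B / 2 \<le> B - 2\<close> as \<open>B \<ge> 4\<close>.\<close>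
  have "1 / (1 - d) \<le> real N" unfolding N_def by linarith
  then have Nd: "1 \<le> real N * (1 - d)" using d by (simp add: field_simps)
  define B where "B = real s ^ N"
  have "2 ^ 2 \<le> s ^ N" using power_mono[OF s, of 2] power_increasing[OF N, of s] s
    by (meson le_trans one_le_numeral zero_le)
  then have sN: "4 \<le> s ^ N" by simp
  define m where "m = s ^ N - 2"
  have m: "m \<ge> 2" using sN by (simp add: m_def)
  have mB: "real m + 2 = B" using sN by (simp add: m_def B_def of_nat_diff)
  have B4: "4 \<le> B" using mB m by simp
  have "B powr (1 - d) = real s powr (real N * (1 - d))"
    using s by (simp add: B_def powr_powr flip: powr_realpow)
  also have "\<dots> \<ge> real s powr 1" using s Nd by (intro powr_mono) auto
  finally have "2 \<le> B powr (1 - d)" using s by simp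
  then have "2 * B powr d \<le> B powr (1 - d) * B powr d" by (intro mult_right_mono) auto
  also have "\<dots> = B" using B4 by (simp flip: powr_add)
  finally have dm: "(real m + 2) powr d \<le> real m" using mB B4 by simp
  let ?g = "cantor_point m"
  define c where "c = real s ^ (2 * N + 2)"
  have c: "1 \<le> c" unfolding c_def using s by (intro one_le_power) simp
  let ?h = "\<lambda>y. ?g y / c"
  have "?h ` {0..<1} \<subseteq> bifurcation_set (real s)"
  proof
    fix z assume "z \<in> ?h ` {0..<1}"
    then obtain y where y: "y \<in> {0..<1}" "z = ?g y / c" by auto
    have "1 \<le> m" using m by simp
    note range = cantor_point_range[OF this, unfolded mB]
    have "0 < 1 / B" using B4 by simp
    then have "0 < ?g y" "?g y < 1" using range[OF y(1)] by linarith+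
    moreover have "1 / B \<le> frac (B ^ q * ?g y) \<and> frac (B ^ q * ?g y) \<le> 1 - 1 / B" for q
      using cantor_point_orbit[OF \<open>1 \<le> m\<close> y(1), of q] range by (auto simp: mB)
    ultimately have "?g y / real s ^ (2 * N + 2) \<in> bifurcation_set (real s)"
      using N unfolding B_def by (intro scaled_point_in_bifurcation_set[OF s]) auto
    then show "z \<in> bifurcation_set (real s)" using y by (simp add: c_def)
  qed
  then have "hausdorff_measure d (?h ` {0..<1}) \<le> hausdorff_measure d (bifurcation_set (real s))"
    by (rule hausdorff_measure_mono)
  moreover have "hausdorff_measure d (?h ` {0..<1}) \<noteq> 0"
  proof (rule hausdorff_measure_nonzero_if_expanding[OF d(1)])
    have "1 \<le> c powr d" using c d by (simp add: ge_one_powr_ge_zero)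
    moreover have "1 \<le> real m ^ 2" using m by (intro one_le_power) auto
    ultimately have "1 * 1 \<le> real m ^ 2 * c powr d" by (intro mult_mono) auto
    then show "1 \<le> real m ^ 2 * c powr d" by simp
    fix y y' :: real assume y: "y \<in> {0..<1}" "y' \<in> {0..<1}"
    have "\<bar>?g y - ?g y'\<bar> powr d = (c * \<bar>?h y - ?h y'\<bar>) powr d"
      using c by (simp flip: diff_divide_distrib)
    also have "\<dots> = c powr d * \<bar>?h y - ?h y'\<bar> powr d" by (rule powr_mult)
    finally show "\<bar>y - y'\<bar> \<le> real m ^ 2 * c powr d * \<bar>?h y - ?h y'\<bar> powr d"
      using cantor_point_expanding[OF m d(1) dm y] by (simp add: mult_ac)
  qed
  ultimately show ?thesis by (metis le_zero_eq)
qed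

section \<open>Measure and dimension of the bifurcation set\<close>

text \<open>Only even powers of \<open>- s\<close> are used: they are powers of \<open>s ^ (2 * N)\<close>, so the orbit condition becomes
  a restriction on digits.\<close>
lemma bifurcation_set_away_from_zero:
  fixes s :: nat
  assumes s: "s \<ge> 2" and N: "1 / real s ^ (2 * N) \<le> \<delta>"
  shows "bifurcation_set (real s) - {0..<\<delta>} \<subseteq> avoiding (s ^ (2 * N))"
proof
  fix \<gamma> assume g: "\<gamma> \<in> bifurcation_set (real s) - {0..<\<delta>}"
  then have "0 \<le> \<gamma>" "\<gamma> \<le> real s / (real s + 1)" using bifurcation_set_subset[OF s] by auto
  moreover have "real s / (real s + 1) < 1" by simp
  ultimately have g01: "0 \<le> \<gamma>" "\<gamma> < 1" by linarith+
  have gd: "\<delta> \<le> \<gamma>" using g g01 by simp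
  have "0 < 1 / real s ^ (2 * N)" using s by simp
  then have g0: "0 < \<gamma>" using N gd by linarith
  have "1 / real (s ^ (2 * N)) \<le> frac (real (s ^ (2 * N)) ^ k * \<gamma>)" for k
  proof -
    have "real (s ^ (2 * N)) ^ k = (- real s) ^ (2 * N * k)" by (simp add: power_mult)
    then show ?thesis
      using bifurcation_set_orbit_ge[OF s g0, of "2 * N * k"] g N gd by simp
  qed
  then show "\<gamma> \<in> avoiding (s ^ (2 * N))" using g01 by (simp add: avoiding_def)
qed

lemma two_le_even_power: "s \<ge> 2 \<Longrightarrow> N \<ge> 1 \<Longrightarrow> 2 \<le> (s::nat) ^ (2 * N)"
  by (metis dual_order.trans le_add2 le_add_same_cancel1 mult_2 one_le_numeral
      power_increasing power_one_right self_le_power zero_less_iff_neq_zero not_one_le_zero)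

lemma hausdorff_dim_le: "0 \<le> d \<Longrightarrow> hausdorff_measure d A = 0 \<Longrightarrow> hausdorff_dim A \<le> ennreal d"
  unfolding hausdorff_dim_def by (rule Inf_lower) auto

lemma bifurcation_set_null:
  fixes s :: nat
  assumes s: "s \<ge> 2"
  shows "bifurcation_set (real s) \<in> null_sets lebesgue"
proof -
  let ?E = "bifurcation_set (real s)"
  have "?E \<subseteq> {0} \<union> (\<Union>N. avoiding (s ^ (2 * Suc N)))"
  proof
    fix \<gamma> assume g: "\<gamma> \<in> ?E"
    show "\<gamma> \<in> {0} \<union> (\<Union>N. avoiding (s ^ (2 * Suc N)))"
    proof (cases "\<gamma> = 0")
      case False
      then have g0: "0 < \<gamma>" using g bifurcation_set_subset[OF s] by force
      obtain n where n: "(1 / real s) ^ n < \<gamma>"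
        using real_arch_pow_inv[OF g0, of "1 / real s"] s by auto
      have "1 / real s ^ (2 * Suc n) \<le> 1 / real s ^ n"
        using s by (intro divide_left_mono power_increasing) auto
      then have "1 / real s ^ (2 * Suc n) \<le> \<gamma>" using n by (simp add: power_divide)
      from bifurcation_set_away_from_zero[OF s this] show ?thesis using g by auto
    qed simp
  qed
  moreover have "negligible (\<Union>N. avoiding (s ^ (2 * Suc N)))"
  proof (rule negligible_countable_Union)
    fix T assume "T \<in> range (\<lambda>N. avoiding (s ^ (2 * Suc N)))"
    then obtain N where "T = avoiding (s ^ (2 * Suc N))" by blast
    moreover have "2 \<le> s ^ (2 * Suc N)" by (rule two_le_even_power[OF s]) simp
    ultimately show "negligible T" using negligible_avoiding by blast
  qed simp
  ultimately have "negligible ?E" by (meson negligible_Un negligible_sing negligible_subset)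
  then show ?thesis by (simp add: negligible_iff_null_sets)
qed

lemma hausdorff_dim_bifurcation_set:
  fixes s :: nat
  assumes s: "s \<ge> 2"
  shows "hausdorff_dim (bifurcation_set (real s)) = 1"
proof (rule antisym)
  have "real s / (real s + 1) \<le> 1" by simp
  then have "{0 .. real s / (real s + 1)} \<subseteq> {0..1}" by (simp add: atLeastatMost_subset_iff)
  with bifurcation_set_subset[OF s] have sub: "bifurcation_set (real s) \<subseteq> {0..1}" by (rule subset_trans)
  show "hausdorff_dim (bifurcation_set (real s)) \<le> 1"
  proof (rule ennreal_le_epsilon)
    fix e :: real assume e: "0 < e"
    have "hausdorff_measure (1 + e) (bifurcation_set (real s)) \<le> 0"
      using hausdorff_measure_mono[OF sub, of "1 + e"] hausdorff_measure_unit_interval[of "1 + e"] e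
      by simp
    then show "hausdorff_dim (bifurcation_set (real s)) \<le> 1 + ennreal e"
      using hausdorff_dim_le[of "1 + e" "bifurcation_set (real s)"] e by simp
  qed
  show "1 \<le> hausdorff_dim (bifurcation_set (real s))"
    unfolding hausdorff_dim_def
  proof (rule Inf_greatest)
    fix x assume "x \<in> {ennreal d |d. 0 \<le> d \<and> hausdorff_measure d (bifurcation_set (real s)) = 0}"
    then obtain d where "x = ennreal d" "0 \<le> d" "hausdorff_measure d (bifurcation_set (real s)) = 0"
      by blast
    then show "1 \<le> x" using hausdorff_measure_bifurcation_set_nonzero[OF s, of d] by force
  qed
qed

lemma hausdorff_dim_away_from_zero:
  fixes s :: nat
  assumes s: "s \<ge> 2" and \<delta>: "\<delta> > 0"
  shows "hausdorff_dim (bifurcation_set (real s) - {0..<\<delta>}) < 1"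
proof -
  obtain n where n: "(1 / real s) ^ n < \<delta>"
    using real_arch_pow_inv[OF \<delta>, of "1 / real s"] s by auto
  have "1 / real s ^ (2 * Suc n) \<le> 1 / real s ^ n"
    using s by (intro divide_left_mono power_increasing) auto
  then have N: "1 / real s ^ (2 * Suc n) \<le> \<delta>" using n by (simp add: power_divide)
  have "2 \<le> s ^ (2 * Suc n)" by (rule two_le_even_power[OF s]) simp
  from hausdorff_measure_avoiding[OF this] obtain d where
    d: "0 < d" "d < 1" "hausdorff_measure d (avoiding (s ^ (2 * Suc n))) = 0" by blast
  then have "hausdorff_measure d (bifurcation_set (real s) - {0..<\<delta>}) \<le> 0"
    using hausdorff_measure_mono[OF bifurcation_set_away_from_zero[OF s N], of d] by simp
  then have "hausdorff_dim (bifurcation_set (real s) - {0..<\<delta>}) \<le> ennreal d"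
    using d by (intro hausdorff_dim_le) auto
  also have "\<dots> < 1" using d by simp
  finally show ?thesis .
qed

theorem theorem4:
  fixes s :: nat
  assumes "s \<ge> 2"
  shows "bifurcation_set (real s) \<subseteq> {0 .. real s / (real s + 1)} \<and>
    bifurcation_set (real s) \<in> null_sets lebesgue \<and>
    hausdorff_dim (bifurcation_set (real s)) = 1 \<and>
    (\<forall>\<delta>>0. hausdorff_dim (bifurcation_set (real s) - {0..<\<delta>}) < 1)"
  using assms bifurcation_set_subset bifurcation_set_null hausdorff_dim_bifurcation_set
    hausdorff_dim_away_from_zero by blast

end
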